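(* Let $\mu$ be a probability measure on $\mathbb R$. The following statements are equivalent. (a) $\mu$ is monotonically selfdecomposable, i.e. for every $c\in(0,1)$ there exists a probability measure $\overline\mu^{c}$ on $\mathbb R$ such that $\mu=(D_c\mu)\rhd\overline\mu^{c}$. (b) $F_\mu$ is univalent and starlike with respect to $\infty$ in the sense that $c\cdot F_\mu(\mathbb C^+)\subset F_\mu(\mathbb C^+)$ for all $c\in(1,\infty)$. (c) $\operatorname{Im}\left(\frac{F_\mu'(z)}{F_\mu(z)}\right)\le 0$ for all $z\in\mathbb C^+$. (d) There exists a probability measure $\nu$ on $\mathbb R$ satisfying $\int_{\mathbb R}\log(1+|x|)\,\nu(dx)<\infty$ such that $$F_\mu(z)=\exp\left(\int_{\mathbb R}\log(z-x)\,\nu(dx)\right),\qquad z\in\mathbb C^+.$$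
   Context: $\mathbb{C}^+=\{z\in\mathbb{C}:\operatorname{Im} z>0\}$. For a probability measure $\mu$ on $\mathbb{R}$, $G_\mu(z)=\int_{\mathbb R}\frac{1}{z-x}\mu(dx)$ and $F_\mu(z)=1/G_\mu(z)$ for $z\in\mathbb C^+$; $F_\mu$ maps $\mathbb C^+$ to $\mathbb C^+$. Univalent means holomorphic and injective. The monotone convolution $\mu\rhd\nu$ is the probability measure on $\mathbb R$ with $F_{\mu\rhd\nu}=F_\mu\circ F_\nu$. For $c>0$, $D_c\mu$ is the dilation $(D_c\mu)(A)=\mu(A/c)$ for Borel $A\subset\mathbb R$. $\log$ is the principal branch. *)

theory Defs
  imports "HOL-Probability.Probability"
begin

text \<open>Probability measures on the real line are elements of \<^typ>\<open>real measure\<close> satisfying the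
  library locale \<^const>\<open>real_distribution\<close> (Borel sigma-algebra, total mass one).\<close>

definition upper_half_plane :: "complex set" where
  "upper_half_plane = {z. 0 < Im z}"

definition cauchy_transform :: "real measure \<Rightarrow> complex \<Rightarrow> complex" where
  "cauchy_transform \<mu> z = (LINT x|\<mu>. 1 / (z - complex_of_real x))"

definition F_transform :: "real measure \<Rightarrow> complex \<Rightarrow> complex" where
  "F_transform \<mu> z = 1 / cauchy_transform \<mu> z"

text \<open>The description is meaningful because a probability measure with the given F-transform
  exists and is unique (the F-transform determines the measure).  The condition is imposed on the
  upper half-plane only, as that is where F-transforms are considered.\<close>

definition monotone_convolution :: "real measure \<Rightarrow> real measure \<Rightarrow> real measure"
    (infixl "\<rhd>\<^sub>m" 70) where
  "\<mu> \<rhd>\<^sub>m \<nu> = (THE \<rho>. real_distribution \<rho> \<and>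
      (\<forall>z\<in>upper_half_plane. F_transform \<rho> z = F_transform \<mu> (F_transform \<nu> z)))"

definition dilation :: "real \<Rightarrow> real measure \<Rightarrow> real measure" where
  "dilation c \<mu> = distr \<mu> borel (\<lambda>x. c * x)"

lemma emeasure_dilation:
  assumes "real_distribution \<mu>" "0 < c" "A \<in> sets borel"
  shows "emeasure (dilation c \<mu>) A = emeasure \<mu> ((\<lambda>x. x / c) ` A)"
proof -
  interpret real_distribution \<mu> by fact
  have "(\<lambda>x. c * x) -` A \<inter> space \<mu> = (\<lambda>x. x / c) ` A"
    using assms(2) by (force simp: image_iff field_simps)
  then show ?thesis
    unfolding dilation_def using assms(3) by (subst emeasure_distr) auto
qed

definition monotonically_selfdecomposable :: "real measure \<Rightarrow> bool" where
  "monotonically_selfdecomposable \<mu> \<longleftrightarrow>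
    (\<forall>c\<in>{0<..<1}. \<exists>\<nu>. real_distribution \<nu> \<and> \<mu> = dilation c \<mu> \<rhd>\<^sub>m \<nu>)"

definition univalent_on :: "(complex \<Rightarrow> complex) \<Rightarrow> complex set \<Rightarrow> bool" where
  "univalent_on f S \<longleftrightarrow> f holomorphic_on S \<and> inj_on f S"

definition starlike_wrt_infinity :: "complex set \<Rightarrow> bool" where
  "starlike_wrt_infinity S \<longleftrightarrow> (\<forall>c::real. 1 < c \<longrightarrow> (\<lambda>w. complex_of_real c * w) ` S \<subseteq> S)"

end

theory Submission
  imports Defs "HOL-Complex_Analysis.Complex_Analysis"
begin

text \<open>Everything rests on the Nevanlinna-type representation: a holomorphic \<open>G\<close> on the upper
  half-plane with \<open>Im G \<le> 0\<close> and \<open>\<i> y G(\<i> y) \<rightarrow> 1\<close> is the Cauchy transform of a probability measure.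
  It yields the existence of monotone convolutions and, applied to \<open>F'/F\<close>, the measure \<open>\<nu>\<close> of (d).

  (a) implies (c): selfdecomposability provides self-maps \<open>w\<close> of the half-plane with
  \<open>F \<circ> w = (1 + s) F\<close> and \<open>Im w(z) \<ge> (1 + s) Im z\<close>.  The functions \<open>(w - id) / s\<close> map the half-plane
  into itself and stay bounded as \<open>s \<rightarrow> 0\<close>, first at one point high up on the imaginary axis and then
  everywhere by the Schwarz--Pick lemma.  Hence \<open>w \<rightarrow> id\<close>, and the difference quotients of \<open>F\<close> along
  \<open>w\<close> exhibit \<open>F'/F\<close> as a limit of reciprocals of points of the upper half-plane.

  (c) implies (d): \<open>F'/F\<close> is a Cauchy transform; integrating it and comparing moduli along the
  imaginary axis gives, by monotone convergence, the logarithmic moment and the constant.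

  (d) implies (b) and (c): \<open>(log F)' = F'/F\<close> is a Cauchy transform, so it has negative imaginary
  part, whence \<open>log F\<close> is univalent and its image is invariant under positive translations.

  (b) implies (a): \<open>z \<mapsto> c F\<^sup>-\<^sup>1(F(z) / c)\<close> is the F-transform of the required measure.\<close>

section \<open>Cauchy transforms and F-transforms\<close>

text \<open>Two obstacles shape the argument. In (a) nothing ties together the measures belonging to
  different values of \<open>c\<close>, and \<open>F\<close> is not yet known to be injective; so
  \<open>F (w z) = (1 + s) * F z\<close> does not by itself put \<open>w z\<close> near
  \<open>z\<close>. It does so only in a truncated cone around the imaginary axis, where
  \<open>F'\<close> is close to 1, and this is why limits at infinity are taken in cones. In (c) no
  moment is available when the measure is found, so its Cauchy transform is first integrated with a
  normalisation at \<open>\<i>\<close> that requires none; the true logarithmic integral enters only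
  once the moment has been proved. Finally, the convolution is a definite description: existence and
  uniqueness of the measure with a given F-transform must be known before (a) says anything about
  \<open>F\<close>. Uniqueness is Stieltjes inversion, carried out on arguments of logarithms, which
  are bounded, instead of on imaginary parts of Cauchy transforms.\<close>

lemma has_field_derivative_lebesgue_integral:
  fixes g g' :: "complex \<Rightarrow> 'a \<Rightarrow> complex"
  assumes M: "finite_measure M" and r: "0 < r"
    and int: "\<And>z. z \<in> ball z0 r \<Longrightarrow> integrable M (g z)"
    and meas: "g' z0 \<in> borel_measurable M"
    and deriv: "\<And>z x. z \<in> ball z0 r \<Longrightarrow> x \<in> space M \<Longrightarrow>
      ((\<lambda>z. g z x) has_field_derivative g' z x) (at z)"
    and bound: "\<And>z x. z \<in> ball z0 r \<Longrightarrow> x \<in> space M \<Longrightarrow> norm (g' z x) \<le> K"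
  shows "((\<lambda>z. LINT x|M. g z x) has_field_derivative (LINT x|M. g' z0 x)) (at z0)"
proof -
  interpret finite_measure M by fact
  have z0: "z0 \<in> ball z0 r" using r by simp
  have "((\<lambda>z. ((LINT x|M. g z x) - (LINT x|M. g z0 x)) / (z - z0)) \<longlongrightarrow> (LINT x|M. g' z0 x))
      (at z0 within ball z0 r)"
    unfolding tendsto_at_iff_sequentially
  proof (intro allI impI)
    fix X assume "\<forall>i. X i \<in> ball z0 r - {z0}" and X0: "X \<longlonglongrightarrow> z0"
    then have X: "\<And>i. X i \<in> ball z0 r" "\<And>i. X i \<noteq> z0" by auto
    have q: "((LINT x|M. g (X i) x) - (LINT x|M. g z0 x)) / (X i - z0) =
        (LINT x|M. (g (X i) x - g z0 x) / (X i - z0))" for i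
      using int[OF X(1)] int[OF z0] by simp
    have "(\<lambda>i. LINT x|M. (g (X i) x - g z0 x) / (X i - z0)) \<longlonglongrightarrow> (LINT x|M. g' z0 x)"
    proof (rule integral_dominated_convergence)
      show "g' z0 \<in> borel_measurable M" by fact
      show "(\<lambda>x. (g (X i) x - g z0 x) / (X i - z0)) \<in> borel_measurable M" for i
        using int[OF X(1)] int[OF z0] by auto
      show "integrable M (\<lambda>x. K)" by simp
      show "AE x in M. (\<lambda>i. (g (X i) x - g z0 x) / (X i - z0)) \<longlonglongrightarrow> g' z0 x"
      proof (rule AE_I2)
        fix x assume "x \<in> space M"
        from deriv[OF z0 this] have "((\<lambda>z. (g z x - g z0 x) / (z - z0)) \<longlongrightarrow> g' z0 x) (at z0)"
          by (simp add: has_field_derivative_iff)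
        then show "(\<lambda>i. (g (X i) x - g z0 x) / (X i - z0)) \<longlonglongrightarrow> g' z0 x"
          using X X0 by (auto simp: tendsto_at_iff_sequentially comp_def)
      qed
      show "AE x in M. norm ((g (X i) x - g z0 x) / (X i - z0)) \<le> K" for i
      proof (rule AE_I2)
        fix x assume x: "x \<in> space M"
        \<comment> \<open>The mean value inequality on the convex ball turns the bound on the
          derivative into a constant majorant of all difference quotients; it is integrable because
          the measure is finite.\<close>
        have "norm (g (X i) x - g z0 x) \<le> K * norm (X i - z0)"
        proof (rule field_differentiable_bound[where S = "ball z0 r"])
          show "((\<lambda>z. g z x) has_field_derivative g' z x) (at z within ball z0 r)"
            if "z \<in> ball z0 r" for z
            using deriv[OF that x] by (rule has_field_derivative_at_within)
        qed (use X z0 bound x in auto)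
        then show "norm ((g (X i) x - g z0 x) / (X i - z0)) \<le> K"
          using X(2)[of i] by (simp add: norm_divide divide_simps)
      qed
    qed
    then show "((\<lambda>z. ((LINT x|M. g z x) - (LINT x|M. g z0 x)) / (z - z0)) \<circ> X)
        \<longlonglongrightarrow> (LINT x|M. g' z0 x)"
      by (simp add: comp_def q)
  qed
  then show ?thesis
    unfolding has_field_derivative_iff using z0 by (simp add: at_within_open[of z0 "ball z0 r"])
qed

lemma open_upper_half_plane: "open upper_half_plane"
  unfolding upper_half_plane_def by (rule open_halfspace_Im_gt)

lemma convex_upper_half_plane: "convex upper_half_plane"
  unfolding upper_half_plane_def by (rule convex_halfspace_Im_gt)

lemma upper_half_plane_iff [simp]: "z \<in> upper_half_plane \<longleftrightarrow> 0 < Im z"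
  by (simp add: upper_half_plane_def)

lemma ball_Im_gt:
  assumes "w \<in> ball z (Im z / 2)"
  shows "Im z / 2 < Im w"
  using assms abs_Im_le_cmod[of "z - w"] by (auto simp: dist_norm)

lemma Im_le_norm_diff_real: "Im z \<le> norm (z - complex_of_real x)"
  using abs_Im_le_cmod[of "z - of_real x"] by simp

lemma norm_inverse_diff_real:
  assumes "0 < c" "c \<le> Im z"
  shows "norm (1 / (z - complex_of_real x)) \<le> 1 / c"
  using Im_le_norm_diff_real[of z x] assms by (simp add: norm_divide frac_le)

lemma diff_real_nonzero: "0 < Im z \<Longrightarrow> z - complex_of_real x \<noteq> 0"
  by (auto simp: complex_eq_iff)

lemma diff_real_not_nonpos: "0 < Im z \<Longrightarrow> z - complex_of_real x \<notin> \<real>\<^sub>\<le>\<^sub>0"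
  by (auto simp: complex_nonpos_Reals_iff)

text \<open>The difference is a primitive of \<open>1 / (w - x)\<close> taken between
  \<open>\<i>\<close> and \<open>z\<close>; on a convex half-plane containing both points this
  derivative is bounded uniformly in \<open>x\<close>. Hence the normalised logarithm is integrable
  against every probability measure, without a moment condition.\<close>

lemma norm_Ln_diff_bound:
  assumes "0 < Im z"
  shows "norm (Ln (z - complex_of_real x) - Ln (\<i> - complex_of_real x)) \<le> 1 / min 1 (Im z) * norm (z - \<i>)"
proof (rule field_differentiable_bound[where S = "{w. min 1 (Im z) \<le> Im w}"])
  show "convex {w. min 1 (Im z) \<le> Im w}" by (rule convex_halfspace_Im_ge)
  fix w assume "w \<in> {w. min 1 (Im z) \<le> Im w}"
  then have w: "0 < Im w" "min 1 (Im z) \<le> Im w" using assms by auto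
  show "((\<lambda>w. Ln (w - complex_of_real x)) has_field_derivative 1 / (w - of_real x))
      (at w within {w. min 1 (Im z) \<le> Im w})"
    using diff_real_not_nonpos[OF w(1)] by (auto intro!: derivative_eq_intros simp: divide_inverse)
  show "norm (1 / (w - complex_of_real x)) \<le> 1 / min 1 (Im z)"
    by (rule norm_inverse_diff_real) (use w assms in auto)
qed auto

text \<open>The primitive of the Cauchy transform vanishing at \<open>\<i>\<close>; the subtracted term makes the
  integrand bounded in \<open>x\<close>.\<close>

definition log_potential :: "real measure \<Rightarrow> complex \<Rightarrow> complex" where
  "log_potential \<mu> z = (LINT x|\<mu>. Ln (z - complex_of_real x) - Ln (\<i> - complex_of_real x))"

context real_distribution
begin

lemma measurable_Ln_diff:
  assumes "0 < Im z"
  shows "(\<lambda>x. Ln (z - complex_of_real x)) \<in> borel_measurable M"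
proof -
  have "continuous_on UNIV (\<lambda>x::real. Ln (z - complex_of_real x))"
    using diff_real_not_nonpos[OF assms] by (intro continuous_intros) auto
  then show ?thesis
    by (intro measurable_finite_borel borel_measurable_continuous_onI)
qed

lemma integrable_inverse_diff:
  assumes "0 < Im z"
  shows "integrable M (\<lambda>x. 1 / (z - complex_of_real x))"
  by (rule integrable_const_bound[where B = "1 / Im z"])
     (use assms norm_inverse_diff_real[of "Im z" z] in \<open>auto simp del: norm_divide\<close>)

lemma integrable_Ln_diff:
  assumes "0 < Im z"
  shows "integrable M (\<lambda>x. Ln (z - complex_of_real x) - Ln (\<i> - complex_of_real x))"
  by (rule integrable_const_bound[where B = "1 / min 1 (Im z) * norm (z - \<i>)"])
     (use norm_Ln_diff_bound[OF assms] measurable_Ln_diff[OF assms] measurable_Ln_diff[of \<i>]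
       in \<open>auto intro!: borel_measurable_diff\<close>)

lemma log_potential_i [simp]: "log_potential M \<i> = 0"
  by (simp add: log_potential_def)

lemma has_field_derivative_log_potential:
  assumes z: "0 < Im z"
  shows "(log_potential M has_field_derivative cauchy_transform M z) (at z)"
  unfolding log_potential_def[abs_def] cauchy_transform_def
proof (rule has_field_derivative_lebesgue_integral[where r = "Im z / 2" and K = "1 / (Im z / 2)"])
  fix w :: complex and x assume "w \<in> ball z (Im z / 2)"
  then have w: "Im z / 2 < Im w" "0 < Im w" using ball_Im_gt[of w z] z by auto
  show "((\<lambda>w. Ln (w - complex_of_real x) - Ln (\<i> - complex_of_real x)) has_field_derivative
      1 / (w - complex_of_real x)) (at w)"
    using diff_real_not_nonpos[OF w(2)] by (auto intro!: derivative_eq_intros simp: divide_inverse)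
  show "norm (1 / (w - complex_of_real x)) \<le> 1 / (Im z / 2)"
    by (rule norm_inverse_diff_real) (use w z in auto)
next
  fix w assume "w \<in> ball z (Im z / 2)"
  then have "0 < Im w" using ball_Im_gt[of w z] z by auto
  then show "integrable M (\<lambda>x. Ln (w - complex_of_real x) - Ln (\<i> - complex_of_real x))"
    by (rule integrable_Ln_diff)
qed (use z finite_measure_axioms in auto)

lemma has_field_derivative_cauchy_transform:
  assumes z: "0 < Im z"
  shows "(cauchy_transform M has_field_derivative (LINT x|M. - (1 / (z - complex_of_real x))\<^sup>2)) (at z)"
  unfolding cauchy_transform_def[abs_def]
proof (rule has_field_derivative_lebesgue_integral[where r = "Im z / 2" and K = "(1 / (Im z / 2))\<^sup>2"])
  fix w :: complex and x assume "w \<in> ball z (Im z / 2)"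
  then have w: "Im z / 2 < Im w" "0 < Im w" using ball_Im_gt[of w z] z by auto
  show "((\<lambda>w. 1 / (w - complex_of_real x)) has_field_derivative
      - (1 / (w - complex_of_real x))\<^sup>2) (at w)"
    using diff_real_nonzero[OF w(2), of x]
    by (auto intro!: derivative_eq_intros simp: divide_simps power2_eq_square)
  have "norm (1 / (w - complex_of_real x)) ^ 2 \<le> (1 / (Im z / 2))^2"
    by (rule power_mono[OF norm_inverse_diff_real]) (use w z in auto)
  then show "norm (- (1 / (w - complex_of_real x))\<^sup>2) \<le> (1 / (Im z / 2))\<^sup>2"
    by (simp only: norm_minus_cancel norm_power)
next
  fix w assume "w \<in> ball z (Im z / 2)"
  then have "0 < Im w" using ball_Im_gt[of w z] z by auto
  then show "integrable M (\<lambda>x. 1 / (w - complex_of_real x))"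
    by (rule integrable_inverse_diff)
qed (use z finite_measure_axioms in auto)

lemma holomorphic_cauchy_transform: "cauchy_transform M holomorphic_on upper_half_plane"
  by (rule holomorphic_onI, rule field_differentiable_at_within)
     (use has_field_derivative_cauchy_transform in \<open>auto simp only: field_differentiable_def upper_half_plane_iff\<close>)

text \<open>The variance of \<open>x \<mapsto> 1 / (z - x)\<close> is nonnegative.\<close>

lemma Im_cauchy_transform_le:
  assumes z: "0 < Im z"
  shows "Im (cauchy_transform M z) \<le> - Im z * (norm (cauchy_transform M z))\<^sup>2"
proof -
  define f where "f = (\<lambda>x. 1 / (z - complex_of_real x))"
  define G where "G = cauchy_transform M z"
  have f [measurable]: "f \<in> borel_measurable M" unfolding f_def by simp
  have fi: "integrable M f" unfolding f_def by (rule integrable_inverse_diff[OF z])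
  have fG: "integral\<^sup>L M f = G" by (simp add: f_def G_def cauchy_transform_def)
  \<comment> \<open>Up to the factor \<open>- Im z\<close>, the imaginary part of
    \<open>1 / (z - x)\<close> is its squared modulus; so the second moment of \<open>f\<close> can
    be read off from \<open>Im G\<close>.\<close>
  have Imf: "Im (f x) = - Im z * (norm (f x))\<^sup>2" for x
    unfolding f_def by (simp add: norm_divide power_divide Im_divide cmod_power2)
  have n2: "integrable M (\<lambda>x. (norm (f x))\<^sup>2)"
  proof -
    have "(norm (f x))\<^sup>2 = - Im (f x) / Im z" for x using Imf[of x] z by simp
    then show ?thesis using fi by simp
  qed
  have ReIm: "integrable M (\<lambda>x. Re (f x))" "integrable M (\<lambda>x. Im (f x))" using fi by auto
  have eq: "(norm (f x - G))\<^sup>2 = (norm (f x))\<^sup>2 + (norm G)\<^sup>2 - 2 * (Re G * Re (f x) + Im G * Im (f x))" for x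
    by (simp add: cmod_power2 power2_diff algebra_simps)
  have "0 \<le> (LINT x|M. (norm (f x - G))\<^sup>2)" by simp
  also have "\<dots> = (LINT x|M. (norm (f x))\<^sup>2) + (norm G)\<^sup>2 - 2 * (Re G * Re G + Im G * Im G)"
    unfolding eq using n2 ReIm fi by (simp add: prob_space[simplified] flip: fG)
  also have "\<dots> = (LINT x|M. (norm (f x))\<^sup>2) - (norm G)\<^sup>2"
    using cmod_power2[of G] by (simp add: power2_eq_square)
  finally have "(norm G)\<^sup>2 \<le> (LINT x|M. (norm (f x))\<^sup>2)" by simp
  moreover have "Im G = - Im z * (LINT x|M. (norm (f x))\<^sup>2)"
  proof -
    have "Im G = (LINT x|M. Im (f x))" using fi by (simp flip: fG)
    then show ?thesis by (simp add: Imf)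
  qed
  ultimately show ?thesis using z by (simp add: G_def mult_left_mono)
qed

lemma Im_cauchy_transform_neg:
  assumes z: "0 < Im z"
  shows "Im (cauchy_transform M z) < 0"
proof -
  have neg: "Im (1 / (z - complex_of_real x)) < 0" for x
    using diff_real_nonzero[OF z, of x] z by (simp add: Im_divide divide_simps sum_power2_gt_zero_iff)
  have "(LINT x|M. Im (1 / (z - complex_of_real x))) < (LINT x|M. 0)"
    by (rule integral_less_AE_space)
       (use neg integrable_inverse_diff[OF z] emeasure_space_1 in auto)
  then show ?thesis
    unfolding cauchy_transform_def using integrable_inverse_diff[OF z] by simp
qed

lemma cauchy_transform_nonzero: "0 < Im z \<Longrightarrow> cauchy_transform M z \<noteq> 0"
  using Im_cauchy_transform_neg[of z] by auto

lemma F_transform_nonzero: "0 < Im z \<Longrightarrow> F_transform M z \<noteq> 0"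
  using cauchy_transform_nonzero[of z] by (simp add: F_transform_def)

text \<open>Since \<open>Im (1 / G)\<close> equals \<open>- Im G / (norm G)\<^sup>2\<close>, this is
  the variance inequality divided by \<open>(norm G)\<^sup>2\<close>.\<close>

lemma Im_F_transform_ge:
  assumes z: "0 < Im z"
  shows "Im z \<le> Im (F_transform M z)"
proof -
  define G where "G = cauchy_transform M z"
  have "G \<noteq> 0" using cauchy_transform_nonzero[OF z] by (simp add: G_def)
  moreover have "Im z * (norm G)\<^sup>2 \<le> - Im G" using Im_cauchy_transform_le[OF z] by (simp add: G_def)
  ultimately show ?thesis
    unfolding F_transform_def G_def[symmetric]
    using sum_power2_gt_zero_iff[of "Re G" "Im G"]
    by (simp add: Im_divide cmod_power2 complex_eq_iff pos_divide_le_eq[symmetric] field_simps)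
qed

lemma Im_F_transform_pos: "0 < Im z \<Longrightarrow> 0 < Im (F_transform M z)"
  using Im_F_transform_ge[of z] by simp

lemma holomorphic_F_transform: "F_transform M holomorphic_on upper_half_plane"
  unfolding F_transform_def[abs_def]
  by (intro holomorphic_intros holomorphic_cauchy_transform) (auto simp: cauchy_transform_nonzero)

lemma has_field_derivative_F_transform:
  "0 < Im z \<Longrightarrow> (F_transform M has_field_derivative deriv (F_transform M) z) (at z)"
  by (rule holomorphic_derivI[OF holomorphic_F_transform open_upper_half_plane]) simp

end

section \<open>Nontangential limits and uniqueness\<close>

text \<open>Convergence to infinity inside a cone around the imaginary axis, as a filter so that
  limits can be composed. For \<open>C < 1\<close> the cone contains no point of the upper
  half-plane and the filter is trivial.\<close>

definition nontangential :: "real \<Rightarrow> complex filter" where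
  "nontangential C = inf (filtercomap Im at_top) (principal {z. norm z \<le> C * Im z})"

lemma eventually_nontangential:
  "eventually P (nontangential C) \<longleftrightarrow> (\<exists>R>0. \<forall>z. R \<le> Im z \<longrightarrow> norm z \<le> C * Im z \<longrightarrow> P z)"
proof -
  have "eventually P (nontangential C) \<longleftrightarrow> (\<exists>R. \<forall>z. R \<le> Im z \<longrightarrow> norm z \<le> C * Im z \<longrightarrow> P z)"
    unfolding nontangential_def eventually_inf_principal eventually_filtercomap_at_top_linorder by auto
  also have "\<dots> \<longleftrightarrow> (\<exists>R>0. \<forall>z. R \<le> Im z \<longrightarrow> norm z \<le> C * Im z \<longrightarrow> P z)"
  proof
    assume "\<exists>R. \<forall>z. R \<le> Im z \<longrightarrow> norm z \<le> C * Im z \<longrightarrow> P z"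
    then obtain R where R: "\<forall>z. R \<le> Im z \<longrightarrow> norm z \<le> C * Im z \<longrightarrow> P z" ..
    show "\<exists>R>0. \<forall>z. R \<le> Im z \<longrightarrow> norm z \<le> C * Im z \<longrightarrow> P z"
      by (rule exI[of _ "max 1 R"]) (use R in simp)
  qed blast
  finally show ?thesis .
qed

lemma filterlim_nontangential_imaginary_axis:
  "1 \<le> C \<Longrightarrow> filterlim (\<lambda>y. \<i> * of_real y) (nontangential C) at_top"
  unfolding filterlim_iff eventually_nontangential eventually_at_top_linorder
proof (intro allI impI, elim exE conjE)
  fix P R assume "1 \<le> C" and R: "0 < R" and P: "\<forall>z. R \<le> Im z \<longrightarrow> norm z \<le> C * Im z \<longrightarrow> P z"
  show "\<exists>N. \<forall>n\<ge>N. P (\<i> * complex_of_real n)"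
  proof (intro exI[of _ R] allI impI)
    fix y assume "R \<le> y"
    then show "P (\<i> * complex_of_real y)"
      using P[rule_format, of "\<i> * of_real y"] R \<open>1 \<le> C\<close> by (simp add: norm_mult)
  qed
qed

text \<open>Dominated convergence works along sequences, so limits in a cone are reduced to them:
  failure of the limit yields a counterexample above every height \<open>n + 1\<close>, and these
  form the sequence.\<close>

lemma tendsto_nontangentialI:
  fixes f :: "complex \<Rightarrow> 'a::topological_space"
  assumes "\<And>Z. (\<And>n. real n < Im (Z n)) \<Longrightarrow> (\<And>n. norm (Z n) \<le> C * Im (Z n)) \<Longrightarrow> (\<lambda>n. f (Z n)) \<longlonglongrightarrow> l"
  shows "(f \<longlongrightarrow> l) (nontangential C)"
proof (rule topological_tendstoI, rule ccontr)
  fix S assume S: "open S" "l \<in> S" and "\<not> (\<forall>\<^sub>F z in nontangential C. f z \<in> S)"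
  then have "\<exists>z. real n + 1 \<le> Im z \<and> norm z \<le> C * Im z \<and> f z \<notin> S" for n
    unfolding eventually_nontangential by (metis add_nonneg_pos of_nat_0_le_iff zero_less_one)
  then obtain Z where Z: "\<And>n. real n + 1 \<le> Im (Z n) \<and> norm (Z n) \<le> C * Im (Z n) \<and> f (Z n) \<notin> S"
    by metis
  have "(\<lambda>n. f (Z n)) \<longlonglongrightarrow> l"
  proof (rule assms)
    show "real n < Im (Z n)" "norm (Z n) \<le> C * Im (Z n)" for n
      using Z[of n] by auto
  qed
  then have "\<forall>\<^sub>F n in sequentially. f (Z n) \<in> S"
    using S by (rule topological_tendstoD)
  then show False using Z by (auto simp: eventually_sequentially)
qed

lemma Im_at_top_imp_quotient_tendsto:
  fixes Z :: "nat \<Rightarrow> complex"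
  assumes "\<And>n. real n < Im (Z n)"
  shows "(\<lambda>n. Z n / (Z n - complex_of_real x)) \<longlonglongrightarrow> 1"
proof -
  have pos: "0 < Im (Z n)" for n using assms[of n] of_nat_0_le_iff[of n] by linarith
  have "(\<lambda>n. complex_of_real x / (Z n - of_real x)) \<longlonglongrightarrow> 0"
  proof (rule tendsto_norm_zero_cancel, rule tendsto_sandwich[OF _ _ tendsto_const])
    show "\<forall>\<^sub>F n in sequentially. norm (complex_of_real x / (Z n - of_real x)) \<le> \<bar>x\<bar> / real n"
      using eventually_gt_at_top[of 0]
    proof eventually_elim
      case (elim n)
      have "real n \<le> norm (Z n - of_real x)"
        using Im_le_norm_diff_real[of "Z n" x] assms[of n] by linarith
      then show ?case using elim by (simp add: norm_divide frac_le)
    qed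
    show "(\<lambda>n. \<bar>x\<bar> / real n) \<longlonglongrightarrow> 0" by (rule lim_const_over_n)
  qed auto
  from tendsto_add[OF tendsto_const[of 1] this] show ?thesis
    using diff_real_nonzero[OF pos, of _ x] by (simp add: field_simps)
qed

text \<open>The reason for restricting to cones: \<open>Im z\<close> bounds
  \<open>norm (z - x)\<close> from below uniformly in \<open>x\<close>, which makes \<open>C\<close>
  a majorant for dominated convergence.\<close>

lemma norm_quotient_diff_real_le:
  assumes "0 < Im z" "norm z \<le> C * Im z"
  shows "norm (z / (z - complex_of_real x)) \<le> C"
proof -
  have C: "0 \<le> C" using assms norm_ge_zero[of z] by (smt (verit) mult_neg_pos)
  have "norm z \<le> C * norm (z - complex_of_real x)"
    using assms mult_left_mono[OF Im_le_norm_diff_real[of z x] C] by linarith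
  then show ?thesis
    using diff_real_nonzero[OF assms(1), of x] by (simp add: norm_divide divide_simps)
qed

context real_distribution
begin

lemma cauchy_transform_nontangential: "((\<lambda>z. z * cauchy_transform M z) \<longlongrightarrow> 1) (nontangential C)"
proof (rule tendsto_nontangentialI)
  fix Z :: "nat \<Rightarrow> complex"
  assume Z: "\<And>n. real n < Im (Z n)" "\<And>n. norm (Z n) \<le> C * Im (Z n)"
  have pos: "0 < Im (Z n)" for n using Z(1)[of n] of_nat_0_le_iff[of n] by linarith
  have "(\<lambda>n. LINT x|M. Z n / (Z n - complex_of_real x)) \<longlonglongrightarrow> (LINT x|M. 1)"
    by (rule integral_dominated_convergence[where w = "\<lambda>_. C"])
       (use Im_at_top_imp_quotient_tendsto[of Z] Z norm_quotient_diff_real_le[OF pos Z(2)] in auto)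
  moreover have "Z n * cauchy_transform M (Z n) = (LINT x|M. Z n / (Z n - complex_of_real x))" for n
    unfolding cauchy_transform_def by (subst integral_mult_right_zero[symmetric]) simp
  ultimately show "(\<lambda>n. Z n * cauchy_transform M (Z n)) \<longlonglongrightarrow> 1"
    by (simp add: prob_space[simplified])
qed

lemma deriv_cauchy_transform_nontangential:
  "((\<lambda>z. z\<^sup>2 * deriv (cauchy_transform M) z) \<longlongrightarrow> -1) (nontangential C)"
proof (rule tendsto_nontangentialI)
  fix Z :: "nat \<Rightarrow> complex"
  assume Z: "\<And>n. real n < Im (Z n)" "\<And>n. norm (Z n) \<le> C * Im (Z n)"
  have pos: "0 < Im (Z n)" for n using Z(1)[of n] of_nat_0_le_iff[of n] by linarith
  have "(\<lambda>n. LINT x|M. - (Z n / (Z n - complex_of_real x))\<^sup>2) \<longlonglongrightarrow> (LINT x|M. -1)"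
  proof (rule integral_dominated_convergence[where w = "\<lambda>_. C\<^sup>2"])
    show "AE x in M. (\<lambda>n. - (Z n / (Z n - complex_of_real x))\<^sup>2) \<longlonglongrightarrow> -1"
    proof (rule AE_I2)
      fix x
      show "(\<lambda>n. - (Z n / (Z n - complex_of_real x))\<^sup>2) \<longlonglongrightarrow> -1"
        using tendsto_minus[OF tendsto_power[OF Im_at_top_imp_quotient_tendsto[of Z x, OF Z(1)], of 2]]
        by simp
    qed
    show "AE x in M. norm (- (Z n / (Z n - complex_of_real x))\<^sup>2) \<le> C\<^sup>2" for n
    proof (rule AE_I2)
      fix x
      show "norm (- (Z n / (Z n - complex_of_real x))\<^sup>2) \<le> C\<^sup>2"
        using power_mono[OF norm_quotient_diff_real_le[OF pos Z(2)] norm_ge_zero, of n x 2]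
        by (simp only: norm_minus_cancel norm_power)
    qed
  qed auto
  moreover have "(Z n)\<^sup>2 * deriv (cauchy_transform M) (Z n) =
      (LINT x|M. - (Z n / (Z n - complex_of_real x))\<^sup>2)" for n
    unfolding DERIV_imp_deriv[OF has_field_derivative_cauchy_transform[OF pos]]
    by (subst integral_mult_right_zero[symmetric]) (simp add: power_divide)
  ultimately show "(\<lambda>n. (Z n)\<^sup>2 * deriv (cauchy_transform M) (Z n)) \<longlonglongrightarrow> -1"
    by (simp add: prob_space[simplified])
qed

lemma F_transform_nontangential: "((\<lambda>z. F_transform M z / z) \<longlongrightarrow> 1) (nontangential C)"
  using tendsto_divide[OF tendsto_const cauchy_transform_nontangential, of 1 C]
  by (simp add: F_transform_def mult.commute)

lemma deriv_F_transform:
  assumes "0 < Im z"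
  shows "deriv (F_transform M) z = - deriv (cauchy_transform M) z / (cauchy_transform M z)\<^sup>2"
proof -
  have "cauchy_transform M field_differentiable at z"
    using has_field_derivative_cauchy_transform[OF assms] by (auto simp only: field_differentiable_def)
  then show ?thesis
    unfolding F_transform_def[abs_def]
    by (subst deriv_divide) (auto simp: cauchy_transform_nonzero assms)
qed

lemma deriv_F_transform_nontangential: "(deriv (F_transform M) \<longlongrightarrow> 1) (nontangential C)"
proof (rule Lim_transform_eventually)
  show "((\<lambda>z. - (z\<^sup>2 * deriv (cauchy_transform M) z) / (z * cauchy_transform M z)\<^sup>2) \<longlongrightarrow> 1) (nontangential C)"
    using tendsto_divide[OF tendsto_minus[OF deriv_cauchy_transform_nontangential]
        tendsto_power[OF cauchy_transform_nontangential, of 2]] by simp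
  show "\<forall>\<^sub>F z in nontangential C. - (z\<^sup>2 * deriv (cauchy_transform M) z) / (z * cauchy_transform M z)\<^sup>2 =
      deriv (F_transform M) z"
    unfolding eventually_nontangential
    by (intro exI[of _ 1]) (auto simp: deriv_F_transform power_mult_distrib)
qed

text \<open>By dominated convergence with majorant \<open>1 / y\<close>, the Cauchy transform tends
  to 0 along every sequence going to infinity above height \<open>y\<close>, also horizontally and
  not only in cones. This is what later prevents a curve of preimages from escaping to
  infinity.\<close>

lemma bounded_F_transform_sublevel:
  assumes y: "0 < y"
  shows "bounded {z. y \<le> Im z \<and> norm (F_transform M z) \<le> K}"
proof (rule ccontr)
  assume "\<not> ?thesis"
  then have "\<exists>z. y \<le> Im z \<and> norm (F_transform M z) \<le> K \<and> real n < norm z" for n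
    unfolding bounded_iff not_ex by (metis (no_types, lifting) mem_Collect_eq not_le)
  then obtain Z where Z: "\<And>n. y \<le> Im (Z n)" "\<And>n. norm (F_transform M (Z n)) \<le> K" "\<And>n. real n < norm (Z n)"
    by metis
  have pos: "0 < Im (Z n)" for n using Z(1)[of n] y by simp
  have "(\<lambda>n. cauchy_transform M (Z n)) \<longlonglongrightarrow> (LINT x|M. 0)"
    unfolding cauchy_transform_def
  proof (rule integral_dominated_convergence[where w = "\<lambda>_. 1 / y"])
    show "AE x in M. (\<lambda>n. 1 / (Z n - complex_of_real x)) \<longlonglongrightarrow> 0"
    proof (rule AE_I2, rule tendsto_norm_zero_cancel, rule tendsto_sandwich[OF _ _ tendsto_const])
      fix x
      have "\<forall>\<^sub>F n in sequentially. \<bar>x\<bar> < real n" by real_asymp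
      then show "\<forall>\<^sub>F n in sequentially. norm (1 / (Z n - complex_of_real x)) \<le> 1 / (real n - \<bar>x\<bar>)"
      proof eventually_elim
        case (elim n)
        have "real n - \<bar>x\<bar> \<le> norm (Z n - complex_of_real x)"
          using norm_triangle_ineq2[of "Z n" "complex_of_real x"] Z(3)[of n] by simp
        then show ?case using elim by (simp add: norm_divide frac_le)
      qed
      show "(\<lambda>n. 1 / (real n - \<bar>x\<bar>)) \<longlonglongrightarrow> 0" by real_asymp
    qed auto
    show "AE x in M. norm (1 / (Z n - complex_of_real x)) \<le> 1 / y" for n
      using norm_inverse_diff_real[OF y Z(1)] by auto
  qed auto
  then have lim: "(\<lambda>n. norm (cauchy_transform M (Z n))) \<longlonglongrightarrow> 0" by (simp add: tendsto_norm_zero)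
  have K: "0 < K" using F_transform_nonzero[OF pos, of 0] Z(2)[of 0] by (smt (verit) zero_less_norm_iff)
  have "1 / K \<le> norm (cauchy_transform M (Z n))" for n
    using Z(2)[of n] K cauchy_transform_nonzero[OF pos, of n]
    by (simp add: F_transform_def norm_divide field_simps)
  then have "1 / K \<le> 0" using lim by (intro LIMSEQ_le_const[OF lim]) auto
  then show False using K by simp
qed

end

section \<open>Stieltjes inversion through arguments of logarithms\<close>

lemma Im_Ln_upper_half_plane: "0 < Im z \<Longrightarrow> Im (Ln z) = pi / 2 - arctan (Re z / Im z)"
  using Arg2pi_arctan_upperhalf[of z] Arg2pi_exp[of "Ln z"] Im_Ln_pos_lt_imp[of z]
  by (cases "z = 0") auto

text \<open>Near the real point \<open>a\<close>, the argument of \<open>w - x\<close> tends to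
  \<open>pi\<close> for \<open>x > a\<close> and to 0 for \<open>x < a\<close>. The points
  \<open>a + 1 / N + \<i> / N\<^sup>2\<close> approach \<open>a\<close> tangentially from the right,
  so that for \<open>x = a\<close> the argument tends to 0 as well, whereas a vertical approach
  would give \<open>pi / 2\<close>. The limit is thus the exact tail even if \<open>a\<close> is an
  atom.\<close>

lemma (in real_distribution) Im_Ln_integral_tendsto:
  "(\<lambda>n. LINT x|M. Im (Ln (Complex (a + 1 / Suc n) (1 / (Suc n)\<^sup>2) - complex_of_real x)))
    \<longlonglongrightarrow> pi * prob {a<..}"
proof -
  let ?w = "\<lambda>n. Complex (a + 1 / Suc n) (1 / (Suc n)\<^sup>2)"
  have Im: "0 < Im (?w n)" for n by simp
  have "(\<lambda>n. LINT x|M. Im (Ln (?w n - complex_of_real x))) \<longlonglongrightarrow> (LINT x|M. pi * indicator {a<..} x)"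
  proof (rule integral_dominated_convergence[where w = "\<lambda>_. pi"])
    show "(\<lambda>x. Im (Ln (?w n - complex_of_real x))) \<in> borel_measurable M" for n
      using measurable_Ln_diff[OF Im, of n] by measurable
    show "AE x in M. norm (Im (Ln (?w n - complex_of_real x))) \<le> pi" for n
    proof (rule AE_I2)
      fix x
      show "norm (Im (Ln (?w n - complex_of_real x))) \<le> pi"
        using Im_Ln_pos_lt_imp[of "?w n - complex_of_real x"] by simp
    qed
    show "AE x in M. (\<lambda>n. Im (Ln (?w n - complex_of_real x))) \<longlonglongrightarrow> pi * indicator {a<..} x"
    proof (rule AE_I2)
      fix x
      have eq: "Im (Ln (?w n - complex_of_real x)) =
          pi / 2 - arctan ((a - x) * (real (Suc n))\<^sup>2 + real (Suc n))" for n
      proof -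
        have "(a + 1 / N - x) / (1 / N\<^sup>2) = (a - x) * N\<^sup>2 + N" if "0 < N" for N :: real
          using that by (simp add: field_simps power2_eq_square)
        from this[of "real (Suc n)"] show ?thesis
          by (subst Im_Ln_upper_half_plane) (simp_all del: of_nat_Suc)
      qed
      show "(\<lambda>n. Im (Ln (?w n - complex_of_real x))) \<longlonglongrightarrow> pi * indicator {a<..} x"
      proof (cases "a < x")
        case True
        then have "(\<lambda>n. pi / 2 - arctan ((a - x) * (real (Suc n))\<^sup>2 + real (Suc n))) \<longlonglongrightarrow> pi"
          by real_asymp
        then show ?thesis using True by (simp only: eq) simp
      next
        case False
        then consider "x < a" | "x = a" by linarith
        then have "(\<lambda>n. pi / 2 - arctan ((a - x) * (real (Suc n))\<^sup>2 + real (Suc n))) \<longlonglongrightarrow> 0"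
          by cases (simp, real_asymp)+
        then show ?thesis using False by (simp only: eq) simp
      qed
    qed
  qed (auto intro!: borel_measurable_times)
  then show ?thesis by simp
qed

text \<open>Both log potentials are primitives of the same function and vanish at
  \<open>\<i>\<close>, so they agree. Boundary values of their imaginary parts are tails of the
  measures, up to an additive constant coming from the normalisation.\<close>

lemma cauchy_transform_unique:
  assumes "real_distribution \<mu>" "real_distribution \<nu>"
    and eq: "\<And>z. 0 < Im z \<Longrightarrow> cauchy_transform \<mu> z = cauchy_transform \<nu> z"
  shows "\<mu> = \<nu>"
proof -
  interpret \<mu>: real_distribution \<mu> by fact
  interpret \<nu>: real_distribution \<nu> by fact
  define A where "A \<rho> z = (LINT x|\<rho>. Im (Ln (z - complex_of_real x)))" for \<rho> z
  have "\<exists>c. \<forall>z\<in>upper_half_plane. log_potential \<mu> z - log_potential \<nu> z = c"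
  proof (rule has_field_derivative_zero_constant[OF convex_upper_half_plane])
    fix z assume "z \<in> upper_half_plane"
    then have z: "0 < Im z" by simp
    show "((\<lambda>z. log_potential \<mu> z - log_potential \<nu> z) has_field_derivative 0) (at z within upper_half_plane)"
      using DERIV_diff[OF \<mu>.has_field_derivative_log_potential[OF z] \<nu>.has_field_derivative_log_potential[OF z]] eq[OF z]
      by (simp add: has_field_derivative_at_within)
  qed
  then obtain c where c: "log_potential \<mu> z - log_potential \<nu> z = c" if "0 < Im z" for z
    by auto
  have pot: "log_potential \<mu> z = log_potential \<nu> z" if "0 < Im z" for z
    using c[OF that] c[of \<i>] by simp
  \<comment> \<open>The logarithms need not be integrable separately, but their arguments lie in
    \<open>[0, pi]\<close>; so the imaginary part of the normalised integral splits without any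
    moment.\<close>
  have split: "Im (log_potential \<rho> z) = A \<rho> z - A \<rho> \<i>" if \<rho>: "real_distribution \<rho>" and z: "0 < Im z" for \<rho> z
  proof -
    interpret \<rho>: real_distribution \<rho> by fact
    have "integrable \<rho> (\<lambda>x. Im (Ln (w - complex_of_real x)))" if w: "0 < Im w" for w
    proof (rule \<rho>.integrable_const_bound[where B = pi])
      show "(\<lambda>x. Im (Ln (w - complex_of_real x))) \<in> borel_measurable \<rho>"
        using \<rho>.measurable_Ln_diff[OF w] by measurable
      show "AE x in \<rho>. norm (Im (Ln (w - complex_of_real x))) \<le> pi"
      proof (rule AE_I2)
        fix x
        show "norm (Im (Ln (w - complex_of_real x))) \<le> pi"
          using Im_Ln_pos_lt_imp[of "w - complex_of_real x"] w by simp
      qed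
    qed
    note this[OF z] this[of \<i>]
    then show ?thesis
      using \<rho>.integrable_Ln_diff[OF z] by (simp add: A_def log_potential_def flip: integral_Im)
  qed
  have A: "A \<mu> z - A \<nu> z = A \<mu> \<i> - A \<nu> \<i>" if "0 < Im z" for z
    using split[OF assms(1) that] split[OF assms(2) that] pot[OF that] by simp
  define \<kappa> where "\<kappa> = A \<mu> \<i> - A \<nu> \<i>"
  have tail: "pi * \<mu>.prob {a<..} - pi * \<nu>.prob {a<..} = \<kappa>" for a
  proof (rule LIMSEQ_unique[OF tendsto_diff[OF \<mu>.Im_Ln_integral_tendsto \<nu>.Im_Ln_integral_tendsto]])
    have "A \<mu> (Complex (a + 1 / Suc n) (1 / (Suc n)\<^sup>2)) - A \<nu> (Complex (a + 1 / Suc n) (1 / (Suc n)\<^sup>2)) = \<kappa>" for n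
      by (subst A) (simp_all add: \<kappa>_def)
    then show "(\<lambda>n. (LINT x|\<mu>. Im (Ln (Complex (a + 1 / Suc n) (1 / (Suc n)\<^sup>2) - complex_of_real x))) -
        (LINT x|\<nu>. Im (Ln (Complex (a + 1 / Suc n) (1 / (Suc n)\<^sup>2) - complex_of_real x)))) \<longlonglongrightarrow> \<kappa>"
      by (simp add: A_def)
  qed
  have compl: "measure \<rho> {a<..} = 1 - cdf \<rho> a" if "real_distribution \<rho>" for \<rho> a
  proof -
    interpret \<rho>: real_distribution \<rho> by fact
    have "\<rho>.prob (UNIV - {..a}) = 1 - \<rho>.prob {..a}"
      using \<rho>.prob_compl[of "{..a}"] by simp
    moreover have "UNIV - {..a} = {a<..}" by auto
    ultimately show ?thesis by (simp add: cdf_def)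
  qed
  have cdf: "pi * cdf \<nu> a - pi * cdf \<mu> a = \<kappa>" for a
    using tail[of a] compl[OF assms(1), of a] compl[OF assms(2), of a] by (simp add: algebra_simps)
  \<comment> \<open>The additive constant in the tails does not depend on \<open>a\<close>; letting
    \<open>a\<close> tend to infinity shows that it is 0.\<close>
  have "((\<lambda>a. pi * cdf \<nu> a - pi * cdf \<mu> a) \<longlongrightarrow> pi * 1 - pi * 1) at_top"
    by (intro tendsto_intros \<mu>.cdf_lim_at_top_prob \<nu>.cdf_lim_at_top_prob)
  then have "\<kappa> = 0" by (simp add: cdf tendsto_const_iff)
  then have "cdf \<mu> = cdf \<nu>" using cdf by (auto simp: fun_eq_iff)
  then show ?thesis by (rule cdf_unique[OF assms(1,2)])
qed

section \<open>The Herglotz representation on the disc\<close>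

lemma prob_space_density:
  fixes g :: "'a \<Rightarrow> real"
  assumes "integrable M g" "\<And>x. 0 \<le> g x" "integral\<^sup>L M g = 1"
  shows "prob_space (density M g)"
proof (rule prob_spaceI)
  have "emeasure (density M g) (space (density M g)) = (\<integral>\<^sup>+x. g x \<partial>M)"
    using assms(1) by (subst emeasure_density) (auto intro!: nn_integral_cong)
  also have "\<dots> = 1" using assms by (subst nn_integral_eq_integral) auto
  finally show "emeasure (density M g) (space (density M g)) = 1" .
qed

text \<open>Period 1 makes this the path \<open>circlepath 0 1\<close>, and measures on the circle
  become distributions concentrated on \<open>{0..1}\<close>, to which the compactness theory of
  distributions on the line applies.\<close>

definition unit_circle :: "real \<Rightarrow> complex" where
  "unit_circle t = exp (2 * of_real pi * \<i> * of_real t)"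

lemma norm_unit_circle [simp]: "norm (unit_circle t) = 1"
  by (simp add: unit_circle_def)

lemma unit_circle_nonzero [simp]: "unit_circle t \<noteq> 0"
  by (simp add: unit_circle_def)

lemma continuous_on_unit_circle [continuous_intros]: "continuous_on A unit_circle"
  unfolding unit_circle_def by (intro continuous_intros)

lemma cnj_unit_circle: "cnj (unit_circle t) = 1 / unit_circle t"
  using complex_norm_square[of "unit_circle t"] by (simp add: field_simps)

lemma unit_circle_diff_nonzero: "norm \<zeta> < 1 \<Longrightarrow> unit_circle t - \<zeta> \<noteq> 0"
  by (metis eq_iff_diff_eq_0 less_irrefl norm_unit_circle)

lemma Cauchy_integral_unit_circle:
  assumes "f holomorphic_on ball 0 R" "1 < R" "norm \<zeta> < 1"
  shows "((\<lambda>t. f (unit_circle t) * unit_circle t / (unit_circle t - \<zeta>)) has_integral f \<zeta>) {0..1}"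
proof -
  have sub: "cball 0 1 \<subseteq> ball (0::complex) R" "ball 0 1 \<subseteq> ball (0::complex) R" using assms(2) by auto
  have "((\<lambda>u. f u / (u - \<zeta>)) has_contour_integral (2 * of_real pi * \<i> * f \<zeta>)) (circlepath 0 1)"
    by (rule Cauchy_integral_circlepath)
       (use assms sub in \<open>auto intro: holomorphic_on_subset holomorphic_on_imp_continuous_on\<close>)
  moreover have "circlepath 0 1 = unit_circle"
    by (simp add: circlepath unit_circle_def fun_eq_iff)
  moreover have "vector_derivative unit_circle (at t) = 2 * pi * \<i> * unit_circle t" for t
    using vector_derivative_circlepath[of 0 1 t] unfolding calculation(2) by (simp add: unit_circle_def)
  ultimately have "((\<lambda>t. f (unit_circle t) / (unit_circle t - \<zeta>) * (2 * pi * \<i> * unit_circle t))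
      has_integral 2 * of_real pi * \<i> * f \<zeta>) {0..1}"
    by (simp add: has_contour_integral)
  from has_integral_mult_right[OF this, of "1 / (2 * of_real pi * \<i>)"] show ?thesis
    by (simp add: field_simps)
qed

text \<open>Schwarz's integral formula: the Cauchy formula for \<open>f\<close> is added to the conjugate of the one for
  \<open>u \<mapsto> f u / (1 - cnj \<zeta> u)\<close> at the origin.\<close>

lemma Schwarz_integral_unit_circle:
  assumes f: "f holomorphic_on ball 0 R" and R: "1 < R" and \<zeta>: "norm \<zeta> < 1"
  shows "((\<lambda>t. Re (f (unit_circle t)) * ((unit_circle t + \<zeta>) / (unit_circle t - \<zeta>)))
    has_integral f \<zeta> - \<i> * Im (f 0)) {0..1}"
proof -
  have one: "((\<lambda>t. 2 * Re (f (unit_circle t)) * (unit_circle t / (unit_circle t - \<zeta>)))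
      has_integral f \<zeta> + cnj (f 0)) {0..1}" if \<zeta>: "norm \<zeta> < 1" for \<zeta>
  proof -
    \<comment> \<open>The function \<open>f u / (1 - cnj \<zeta> * u)\<close> has its pole at
      modulus \<open>1 / norm \<zeta>\<close>. The case \<open>\<zeta> = 0\<close> is separate
      because \<open>1 / 0 = 0\<close> would collapse the minimum to 0.\<close>
    define R' where "R' = (if \<zeta> = 0 then R else min R (1 / norm \<zeta>))"
    have R': "1 < R'" "R' \<le> R" using R \<zeta> by (auto simp: R'_def)
    have nz: "1 - cnj \<zeta> * u \<noteq> 0" if "u \<in> ball 0 R'" for u
    proof
      assume "1 - cnj \<zeta> * u = 0"
      then have "norm (cnj \<zeta> * u) = 1" by (metis eq_iff_diff_eq_0 norm_one)
      then have "norm \<zeta> * norm u = 1" by (simp add: norm_mult)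
      then show False using that by (auto simp: R'_def field_simps split: if_splits)
    qed
    have "(\<lambda>u. f u / (1 - cnj \<zeta> * u)) holomorphic_on ball 0 R'"
      using nz R' by (intro holomorphic_intros holomorphic_on_subset[OF f]) auto
    from Cauchy_integral_unit_circle[OF this R'(1), of 0]
    have "((\<lambda>t. f (unit_circle t) / (1 - cnj \<zeta> * unit_circle t)) has_integral f 0) {0..1}"
      by simp
    then have "(cnj \<circ> (\<lambda>t. f (unit_circle t) / (1 - cnj \<zeta> * unit_circle t)) has_integral cnj (f 0)) {0..1}"
      by (simp only: has_integral_cnj)
    moreover have "cnj \<circ> (\<lambda>t. f (unit_circle t) / (1 - cnj \<zeta> * unit_circle t)) =
        (\<lambda>t. cnj (f (unit_circle t)) * unit_circle t / (unit_circle t - \<zeta>))"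
    proof
      fix t
      have "1 - \<zeta> / unit_circle t = (unit_circle t - \<zeta>) / unit_circle t" by (simp add: field_simps)
      then show "(cnj \<circ> (\<lambda>t. f (unit_circle t) / (1 - cnj \<zeta> * unit_circle t))) t =
        cnj (f (unit_circle t)) * unit_circle t / (unit_circle t - \<zeta>)"
        by (simp add: cnj_unit_circle)
    qed
    ultimately have "((\<lambda>t. f (unit_circle t) * unit_circle t / (unit_circle t - \<zeta>) +
        cnj (f (unit_circle t)) * unit_circle t / (unit_circle t - \<zeta>)) has_integral f \<zeta> + cnj (f 0)) {0..1}"
      using has_integral_add[OF Cauchy_integral_unit_circle[OF f R \<zeta>]] by simp
    moreover have "a * u / v + cnj a * u / v = 2 * Re a * (u / v)" for a u v :: complex
      using complex_add_cnj[of a] by (simp add: distrib_right[symmetric] add_divide_distrib[symmetric])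
    ultimately show ?thesis by simp
  qed
  \<comment> \<open>The Schwarz kernel is \<open>2 * u / (u - \<zeta>) - 1\<close>; half of the
    formula at the origin supplies the subtracted mean of \<open>Re f\<close>.\<close>
  from has_integral_diff[OF one[OF \<zeta>] has_integral_mult_right[OF one[of 0], of "1/2"]]
  have "((\<lambda>t. 2 * Re (f (unit_circle t)) * (unit_circle t / (unit_circle t - \<zeta>)) - Re (f (unit_circle t)))
      has_integral f \<zeta> + cnj (f 0) - (f 0 + cnj (f 0)) / 2) {0..1}"
    by simp
  moreover have "2 * Re (f (unit_circle t)) * (unit_circle t / (unit_circle t - \<zeta>)) - Re (f (unit_circle t)) =
      Re (f (unit_circle t)) * ((unit_circle t + \<zeta>) / (unit_circle t - \<zeta>))" for t
    using unit_circle_diff_nonzero[OF \<zeta>, of t] by (simp add: divide_simps) (simp add: algebra_simps)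
  moreover have "f \<zeta> + cnj (f 0) - (f 0 + cnj (f 0)) / 2 = f \<zeta> - \<i> * Im (f 0)"
    by (simp add: complex_eq_iff)
  ultimately show ?thesis by simp
qed

lemma Schwarz_kernel_bound:
  assumes "norm \<zeta> < 1"
  shows "norm ((unit_circle t + \<zeta>) / (unit_circle t - \<zeta>)) \<le> 2 / (1 - norm \<zeta>)"
proof -
  have "norm (unit_circle t + \<zeta>) \<le> 2"
    using norm_triangle_ineq[of "unit_circle t" \<zeta>] assms by simp
  moreover have "1 - norm \<zeta> \<le> norm (unit_circle t - \<zeta>)"
    using norm_triangle_ineq2[of "unit_circle t" \<zeta>] by simp
  ultimately show ?thesis
    unfolding norm_divide by (intro frac_le) (use assms in auto)
qed

lemma continuous_on_Schwarz_kernel: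
  assumes "norm \<zeta> < 1"
  shows "continuous_on UNIV (\<lambda>t. (unit_circle t + \<zeta>) / (unit_circle t - \<zeta>))"
  using unit_circle_diff_nonzero[OF assms] by (auto intro!: continuous_intros)

text \<open>When \<open>f\<close> extends across the circle, Schwarz's formula exhibits the measure:
  its density is \<open>Re f / Re (f 0)\<close> on \<open>{0..1}\<close>. The mass on
  \<open>{-1<..1}\<close> is recorded in the half-open form used by \<open>tight\<close>, with an
  interval independent of \<open>f\<close>.\<close>

lemma Herglotz_closed_disc:
  assumes f: "f holomorphic_on ball 0 R" and R: "1 < R"
    and nonneg: "\<And>\<zeta>. norm \<zeta> \<le> 1 \<Longrightarrow> 0 \<le> Re (f \<zeta>)" and pos: "0 < Re (f 0)"
  shows "\<exists>M. real_distribution M \<and> measure M {-1<..1} = 1 \<and>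
    (\<forall>\<zeta>. norm \<zeta> < 1 \<longrightarrow>
      f \<zeta> = \<i> * Im (f 0) + Re (f 0) * (LINT t|M. (unit_circle t + \<zeta>) / (unit_circle t - \<zeta>)))"
proof -
  define g where "g = (\<lambda>t. indicator {0..1} t * (Re (f (unit_circle t)) / Re (f 0)))"
  have cf: "continuous_on UNIV (\<lambda>t. f (unit_circle t))"
    by (rule continuous_on_compose2[OF holomorphic_on_imp_continuous_on[OF f]])
       (use R in \<open>auto intro: continuous_intros\<close>)
  have [measurable]: "(\<lambda>t. f (unit_circle t)) \<in> borel_measurable borel"
    using cf by (rule borel_measurable_continuous_onI)
  have gm [measurable]: "g \<in> borel_measurable borel" unfolding g_def by measurable
  have g0: "0 \<le> g t" for t using nonneg[of "unit_circle t"] pos by (simp add: g_def)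
  have kernel: "integrable lborel (\<lambda>t. g t *\<^sub>R ((unit_circle t + \<zeta>) / (unit_circle t - \<zeta>)))"
    "Re (f 0) * (LINT t|lborel. g t *\<^sub>R ((unit_circle t + \<zeta>) / (unit_circle t - \<zeta>))) = f \<zeta> - \<i> * Im (f 0)"
    if \<zeta>: "norm \<zeta> < 1" for \<zeta>
  proof -
    let ?k = "\<lambda>t. Re (f (unit_circle t)) * ((unit_circle t + \<zeta>) / (unit_circle t - \<zeta>))"
    have "continuous_on {0..1} ?k"
      by (intro continuous_intros continuous_on_subset[OF cf] continuous_on_subset[OF continuous_on_Schwarz_kernel[OF \<zeta>]]) auto
    then have int: "set_integrable lborel {0..1} ?k"
      using borel_integrable_atLeastAtMost'[of 0 1 ?k] by simp
    have eq: "g t *\<^sub>R ((unit_circle t + \<zeta>) / (unit_circle t - \<zeta>)) =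
        (1 / Re (f 0)) *\<^sub>R (indicator {0..1} t *\<^sub>R ?k t)" for t
      by (simp add: g_def scaleR_conv_of_real)
    show "integrable lborel (\<lambda>t. g t *\<^sub>R ((unit_circle t + \<zeta>) / (unit_circle t - \<zeta>)))"
      unfolding eq using int unfolding set_integrable_def by (rule integrable_scaleR_right)
    have "(LINT t|lborel. g t *\<^sub>R ((unit_circle t + \<zeta>) / (unit_circle t - \<zeta>))) =
        (1 / Re (f 0)) *\<^sub>R (LINT t:{0..1}|lborel. ?k t)"
      unfolding eq set_lebesgue_integral_def by (rule integral_scaleR_right)
    also have "(LINT t:{0..1}|lborel. ?k t) = f \<zeta> - \<i> * Im (f 0)"
      using set_borel_integral_eq_integral(2)[OF int] Schwarz_integral_unit_circle[OF f R \<zeta>]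
      by (simp add: integral_unique)
    finally show "Re (f 0) * (LINT t|lborel. g t *\<^sub>R ((unit_circle t + \<zeta>) / (unit_circle t - \<zeta>))) =
        f \<zeta> - \<i> * Im (f 0)"
      using pos by (simp add: scaleR_conv_of_real)
  qed
  \<comment> \<open>At \<open>\<zeta> = 0\<close> the kernel is identically 1, so the formula there
    contains both the integrability and the total mass of \<open>g\<close>.\<close>
  have gi: "integrable lborel g"
  proof -
    have "integrable lborel (\<lambda>t. Re (g t *\<^sub>R (1::complex)))"
      using kernel(1)[of 0] by (intro integrable_Re) simp
    then show ?thesis by simp
  qed
  have "complex_of_real (integral\<^sup>L lborel g) = (LINT t|lborel. g t *\<^sub>R (1::complex))"
    using gi by (simp add: scaleR_conv_of_real)
  moreover have "Re (f 0) * (LINT t|lborel. g t *\<^sub>R (1::complex)) = Re (f 0)"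
    using kernel(2)[of 0] by (simp del: scaleR_conv_of_real) (simp add: complex_eq_iff)
  ultimately have g1: "integral\<^sup>L lborel g = 1"
    using pos by (simp add: scaleR_conv_of_real)
  define M where "M = density lborel g"
  interpret M: prob_space M
    unfolding M_def by (rule prob_space_density) (use gi g0 g1 in auto)
  interpret M: real_distribution M
    by standard (simp add: M_def)
  have "M.prob {-1<..1} = (LINT t|M. indicator {-1<..1} t)" by simp
  also have "\<dots> = (LINT t|lborel. g t *\<^sub>R indicator {-1<..1} t)"
    unfolding M_def using g0 by (intro integral_density) auto
  also have "\<dots> = integral\<^sup>L lborel g"
    by (intro Bochner_Integration.integral_cong) (auto simp: g_def indicator_def)
  finally have "M.prob {-1<..1} = 1" using g1 by simp
  moreover have "f \<zeta> = \<i> * Im (f 0) + Re (f 0) * (LINT t|M. (unit_circle t + \<zeta>) / (unit_circle t - \<zeta>))"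
    if \<zeta>: "norm \<zeta> < 1" for \<zeta>
  proof -
    have "(LINT t|M. (unit_circle t + \<zeta>) / (unit_circle t - \<zeta>)) =
        (LINT t|lborel. g t *\<^sub>R ((unit_circle t + \<zeta>) / (unit_circle t - \<zeta>)))"
      unfolding M_def using g0 borel_measurable_continuous_onI[OF continuous_on_Schwarz_kernel[OF \<zeta>]]
      by (intro integral_density) auto
    then show ?thesis using kernel(2)[OF \<zeta>] by simp
  qed
  ultimately show ?thesis using M.real_distribution_axioms by blast
qed

text \<open>The functions \<open>f (r * \<zeta>)\<close> with \<open>r < 1\<close> extend across the
  circle, and their measures all sit on one bounded interval. A subsequence converges weakly as
  \<open>r\<close> tends to 1, and for fixed \<open>\<zeta>\<close> the kernel is a bounded
  continuous test function.\<close>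

lemma Herglotz_disc:
  assumes f: "f holomorphic_on ball 0 1"
    and nonneg: "\<And>\<zeta>. norm \<zeta> < 1 \<Longrightarrow> 0 \<le> Re (f \<zeta>)" and pos: "0 < Re (f 0)"
  shows "\<exists>M. real_distribution M \<and>
    (\<forall>\<zeta>. norm \<zeta> < 1 \<longrightarrow>
      f \<zeta> = \<i> * Im (f 0) + Re (f 0) * (LINT t|M. (unit_circle t + \<zeta>) / (unit_circle t - \<zeta>)))"
proof -
  \<comment> \<open>The offset 2 keeps even the first radius positive, so that
    \<open>1 / r n\<close> is a radius beyond the unit circle.\<close>
  define r where "r n = 1 - 1 / real (n + 2)" for n
  have r: "0 < r n" "r n < 1" for n by (auto simp: r_def field_simps)
  have rlim: "r \<longlonglongrightarrow> 1" unfolding r_def by real_asymp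
  have "\<exists>M. real_distribution M \<and> measure M {-1<..1} = 1 \<and>
    (\<forall>\<zeta>::complex. norm \<zeta> < 1 \<longrightarrow>
      f (r n * \<zeta>) = \<i> * Im (f (of_real (r n) * 0)) + Re (f (of_real (r n) * 0)) * (LINT t|M. (unit_circle t + \<zeta>) / (unit_circle t - \<zeta>)))"
    (is "\<exists>M. ?P n M") for n
  proof (rule Herglotz_closed_disc[where f = "\<lambda>\<zeta>. f (of_real (r n) * \<zeta>)" and R = "1 / r n"])
    show "(\<lambda>\<zeta>. f (r n * \<zeta>)) holomorphic_on ball 0 (1 / r n)"
      by (rule holomorphic_on_compose_gen[OF _ f, unfolded comp_def])
         (use r[of n] in \<open>auto intro!: holomorphic_intros simp: norm_mult field_simps\<close>)
    show "1 < 1 / r n" using r[of n] by simp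
    show "0 \<le> Re (f (of_real (r n) * \<zeta>))" if "norm \<zeta> \<le> 1" for \<zeta>
    proof (rule nonneg)
      have "r n * norm \<zeta> \<le> r n * 1" using that r[of n] by (intro mult_left_mono) auto
      then have "r n * norm \<zeta> < 1" using r[of n] by linarith
      then show "norm (of_real (r n) * \<zeta>) < 1" using r[of n] by (simp add: norm_mult)
    qed
  qed (use pos in auto)
  then have "\<forall>n. \<exists>M. ?P n M" by blast
  from choice[OF this] obtain \<mu> where \<mu>0: "\<forall>n. ?P n (\<mu> n)" by blast
  then have \<mu>: "real_distribution (\<mu> n)" "measure (\<mu> n) {-1<..1} = 1" for n by blast+
  have rep: "f (of_real (r n) * \<zeta>) =
      \<i> * Im (f 0) + Re (f 0) * (LINT t|\<mu> n. (unit_circle t + \<zeta>) / (unit_circle t - \<zeta>))"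
    if "norm \<zeta> < 1" for n \<zeta>
    using \<mu>0[THEN spec[of _ n]] that by simp
  have "tight \<mu>"
    unfolding tight_def
  proof (intro conjI allI impI)
    fix \<epsilon> :: real assume "0 < \<epsilon>"
    then show "\<exists>a b. a < b \<and> (\<forall>n. 1 - \<epsilon> < measure (\<mu> n) {a<..b})"
      by (intro exI[of _ "-1"] exI[of _ 1]) (simp add: \<mu>(2))
  qed (rule \<mu>(1))
  from tight_imp_convergent_subsubsequence[OF this strict_mono_id]
  obtain s M where s: "strict_mono s" and M: "real_distribution M" and conv: "weak_conv_m (\<mu> \<circ> s) M"
    by auto
  have "f \<zeta> = \<i> * Im (f 0) + Re (f 0) * (LINT t|M. (unit_circle t + \<zeta>) / (unit_circle t - \<zeta>))"
    if \<zeta>: "norm \<zeta> < 1" for \<zeta>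
  proof (rule LIMSEQ_unique)
    have "(\<lambda>n. LINT t|(\<mu> \<circ> s) n. (unit_circle t + \<zeta>) / (unit_circle t - \<zeta>)) \<longlonglongrightarrow>
        (LINT t|M. (unit_circle t + \<zeta>) / (unit_circle t - \<zeta>))"
    proof (rule weak_conv_imp_integral_bdd_continuous_conv[OF _ M conv])
      show "isCont (\<lambda>t. (unit_circle t + \<zeta>) / (unit_circle t - \<zeta>)) x" for x
        using continuous_on_Schwarz_kernel[OF \<zeta>] by (simp add: continuous_on_eq_continuous_at)
    qed (use \<mu>(1) Schwarz_kernel_bound[OF \<zeta>] in auto)
    then show "(\<lambda>n. f (r (s n) * \<zeta>)) \<longlonglongrightarrow>
        \<i> * Im (f 0) + Re (f 0) * (LINT t|M. (unit_circle t + \<zeta>) / (unit_circle t - \<zeta>))"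
      by (simp add: rep[OF \<zeta>]) (intro tendsto_intros)
    have "(\<lambda>n. r (s n) * \<zeta>) \<longlonglongrightarrow> of_real 1 * \<zeta>"
      by (intro tendsto_intros LIMSEQ_subseq_LIMSEQ[OF rlim s, unfolded comp_def])
    moreover have "isCont f \<zeta>"
      using holomorphic_on_imp_continuous_on[OF f] \<zeta> by (simp add: continuous_on_eq_continuous_at)
    ultimately show "(\<lambda>n. f (r (s n) * \<zeta>)) \<longlonglongrightarrow> f \<zeta>"
      by (auto intro: isCont_tendsto_compose)
  qed
  then show ?thesis using M by blast
qed

section \<open>Representation of functions on the upper half-plane\<close>

lemma Im_cayley:
  assumes "norm \<zeta> < 1"
  shows "0 < Im (\<i> * (1 + \<zeta>) / (1 - \<zeta>))"
proof -
  have "(Re \<zeta>)\<^sup>2 + (Im \<zeta>)\<^sup>2 < 1"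
    using assms by (simp add: cmod_def)
  moreover have "0 < (1 - Re \<zeta>)\<^sup>2 + (Im \<zeta>)\<^sup>2"
    using assms by (auto simp: sum_power2_gt_zero_iff complex_eq_iff cmod_def)
  ultimately show ?thesis
    by (simp add: Im_divide zero_less_divide_iff power2_eq_square algebra_simps)
qed

text \<open>A point of the half-plane is closer to \<open>w\<close> than to its mirror image, so
  \<open>(v - w) / (v - cnj w)\<close> lies in the unit disc. Both the Cayley transform and the
  Schwarz--Pick argument rest on this.\<close>

lemma norm_diff_less_norm_diff_cnj:
  assumes "0 < Im v" "0 < Im w"
  shows "norm (v - w) < norm (v - cnj w)"
proof -
  have "(Im v - Im w)\<^sup>2 < (Im v + Im w)\<^sup>2"
    using assms by (simp add: power2_eq_square algebra_simps)
  then show ?thesis by (simp add: cmod_def)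
qed

text \<open>\<open>X\<close> is the real boundary point corresponding to
  \<open>unit_circle t\<close>, and the kernel is \<open>\<i> * (1 + X * z) / (z - X)\<close>,
  written as a Cauchy kernel of weight \<open>1 + X\<^sup>2\<close> plus a constant. The point 1 of
  the circle corresponds to \<infinity>; there division by zero gives \<open>X\<close> the value 0,
  hence the case distinction.\<close>

lemma nevanlinna_kernel:
  fixes z :: complex and t :: real
  assumes z: "0 < Im z"
  defines "\<zeta> \<equiv> (z - \<i>) / (z + \<i>)"
  defines "X \<equiv> Re (\<i> * (1 + unit_circle t) / (1 - unit_circle t))"
  shows "(unit_circle t + \<zeta>) / (unit_circle t - \<zeta>) =
    (if unit_circle t = 1 then - \<i> * z else \<i> * ((1 + of_real (X\<^sup>2)) / (z - of_real X) + of_real X))"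
proof (cases "unit_circle t = 1")
  case True
  have "z + \<i> \<noteq> 0" using z by (auto simp: complex_eq_iff)
  then show ?thesis using True by (simp add: \<zeta>_def divide_simps)
next
  case False
  define u where "u = unit_circle t"
  have u: "u \<noteq> 1" "u \<noteq> 0" using False by (auto simp: u_def)
  have zi: "z + \<i> \<noteq> 0" using z by (auto simp: complex_eq_iff)
  have "cnj (\<i> * (1 + u) / (1 - u)) = \<i> * (1 + u) / (1 - u)"
    using u by (simp add: u_def cnj_unit_circle divide_simps) (simp add: algebra_simps)
  then have X: "of_real X = \<i> * (1 + u) / (1 - u)"
    unfolding X_def u_def by (metis Reals_cnj_iff of_real_Re)
  have "of_real X * (1 - u) = \<i> * (1 + u)" using u by (simp add: X)
  then have uX: "u * (of_real X + \<i>) = of_real X - \<i>" by (simp add: algebra_simps)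
  have Xi: "of_real X + \<i> \<noteq> 0" by (auto simp: complex_eq_iff)
  have zX: "z - of_real X \<noteq> 0" using diff_real_nonzero[OF z] .
  have "u = (of_real X - \<i>) / (of_real X + \<i>)" using uX Xi by (simp add: field_simps)
  then have "u + \<zeta> = ((of_real X - \<i>) * (z + \<i>) + (z - \<i>) * (of_real X + \<i>)) / ((of_real X + \<i>) * (z + \<i>))"
    and "u - \<zeta> = ((of_real X - \<i>) * (z + \<i>) - (z - \<i>) * (of_real X + \<i>)) / ((of_real X + \<i>) * (z + \<i>))"
    using Xi zi by (simp_all add: \<zeta>_def add_frac_eq diff_frac_eq)
  moreover have "(of_real X - \<i>) * (z + \<i>) + (z - \<i>) * (of_real X + \<i>) = 2 * (1 + of_real X * z)"
    by (simp add: algebra_simps)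
  moreover have "(of_real X - \<i>) * (z + \<i>) - (z - \<i>) * (of_real X + \<i>) = 2 * \<i> * (of_real X - z)"
    by (simp add: algebra_simps)
  ultimately have "(u + \<zeta>) / (u - \<zeta>) = (2 * (1 + of_real X * z)) / (2 * \<i> * (of_real X - z))"
    using Xi zi by simp
  also have "\<dots> = \<i> * ((1 + of_real (X\<^sup>2)) / (z - of_real X) + of_real X)"
  proof -
    have "of_real X - z \<noteq> 0" using zX by auto
    then show ?thesis using zX by (simp add: divide_simps) (simp add: algebra_simps power2_eq_square)
  qed
  finally show ?thesis using False by (simp add: u_def)
qed

text \<open>A function with values in a closed half-plane that is real at one point is constant.\<close>

lemma Im_neg_of_asymptotics:
  assumes G: "G holomorphic_on upper_half_plane"
    and nonpos: "\<And>z. 0 < Im z \<Longrightarrow> Im (G z) \<le> 0"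
    and lim: "((\<lambda>y. \<i> * of_real y * G (\<i> * of_real y)) \<longlongrightarrow> 1) at_top"
  shows "Im (G \<i>) < 0"
proof (rule ccontr)
  assume "\<not> Im (G \<i>) < 0"
  then have G0: "Im (G \<i>) = 0" using nonpos[of \<i>] by simp
  have "G constant_on upper_half_plane"
  proof (rule ccontr)
    assume "\<not> G constant_on upper_half_plane"
    then have "open (G ` upper_half_plane)"
      using open_upper_half_plane convex_connected[OF convex_upper_half_plane]
      by (intro open_mapping_thm[OF G]) auto
    moreover have "G \<i> \<in> G ` upper_half_plane" by (intro imageI) simp
    ultimately obtain e where e: "0 < e" "ball (G \<i>) e \<subseteq> G ` upper_half_plane"
      by (meson openE)
    have "G \<i> + \<i> * of_real (e / 2) \<in> ball (G \<i>) e" using e(1) by (simp add: dist_norm norm_mult)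
    then obtain z where "0 < Im z" "G z = G \<i> + \<i> * of_real (e / 2)" using e(2) by force
    then have "Im (G z) = e / 2" using G0 by simp
    then show False using nonpos[OF \<open>0 < Im z\<close>] e(1) by simp
  qed
  then obtain c where "\<And>z. z \<in> upper_half_plane \<Longrightarrow> G z = c" by (auto simp: constant_on_def)
  then have c: "G (\<i> * of_real y) = c" if "0 < y" for y using that by simp
  have "((\<lambda>y. \<i> * of_real y * c) \<longlongrightarrow> 1) at_top"
    by (rule Lim_transform_eventually[OF lim])
       (use eventually_gt_at_top[of 0] in eventually_elim, simp add: c)
  \<comment> \<open>The function \<open>\<i> * y * c\<close> is homogeneous in \<open>y\<close>:
    replacing \<open>y\<close> by \<open>2 * y\<close> doubles its values but must preserve the
    limit, which therefore cannot be 1.\<close>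
  note lims = this filterlim_compose[OF this filterlim_tendsto_pos_mult_at_top[OF tendsto_const _ filterlim_ident, of 2]]
  have "((\<lambda>y. 2 * (\<i> * of_real y * c)) \<longlongrightarrow> 2 * 1) at_top"
    by (intro tendsto_mult_left lims(1))
  moreover have "((\<lambda>y. 2 * (\<i> * of_real y * c)) \<longlongrightarrow> 1) at_top"
    using lims(2) by (simp add: mult_ac)
  ultimately have "2 * 1 = (1::complex)" by (intro tendsto_unique[where F = at_top]) auto
  then show False by simp
qed

text \<open>The Cayley transform turns \<open>\<i> * G\<close> into a function on the disc to which the Herglotz
  representation applies; the growth condition at \<open>\<infinity>\<close> excludes an atom at the boundary point
  corresponding to \<open>\<infinity>\<close> and makes the transported measure finite.\<close>

theorem cauchy_transform_representation:
  assumes G: "G holomorphic_on upper_half_plane"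
    and nonpos: "\<And>z. 0 < Im z \<Longrightarrow> Im (G z) \<le> 0"
    and lim: "((\<lambda>y. \<i> * of_real y * G (\<i> * of_real y)) \<longlongrightarrow> 1) at_top"
  shows "\<exists>\<nu>. real_distribution \<nu> \<and> (\<forall>z. 0 < Im z \<longrightarrow> cauchy_transform \<nu> z = G z)"
proof -
  define B where "B = - Im (G \<i>)"
  have B: "0 < B" using Im_neg_of_asymptotics[OF assms] by (simp add: B_def)
  define f where "f = (\<lambda>\<zeta>. \<i> * G (\<i> * (1 + \<zeta>) / (1 - \<zeta>)))"
  have "f holomorphic_on ball 0 1"
    unfolding f_def
    by (intro holomorphic_intros holomorphic_on_compose_gen[OF _ G, unfolded comp_def])
       (use Im_cayley in auto)
  moreover have "0 \<le> Re (f \<zeta>)" if "norm \<zeta> < 1" for \<zeta>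
    using nonpos[OF Im_cayley[OF that]] by (simp add: f_def)
  moreover have f0: "f 0 = \<i> * G \<i>" by (simp add: f_def)
  then have Ref0: "Re (f 0) = B" by (simp add: B_def)
  ultimately obtain M where M: "real_distribution M" and
    rep: "\<And>\<zeta>. norm \<zeta> < 1 \<Longrightarrow>
      f \<zeta> = \<i> * Im (f 0) + B * (LINT t|M. (unit_circle t + \<zeta>) / (unit_circle t - \<zeta>))"
    using Herglotz_disc[of f] B by auto
  interpret M: real_distribution M by fact
  define X where "X = (\<lambda>t. Re (\<i> * (1 + unit_circle t) / (1 - unit_circle t)))"
  have [measurable]: "unit_circle \<in> borel_measurable borel"
    by (rule borel_measurable_continuous_onI[OF continuous_on_unit_circle])
  have Xm [measurable]: "X \<in> borel_measurable borel" unfolding X_def by measurable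
  define k where "k z t = (if unit_circle t = 1 then - \<i> * z else
      \<i> * ((1 + of_real ((X t)\<^sup>2)) / (z - of_real (X t)) + of_real (X t)))" for z t
  have km [measurable]: "k z \<in> borel_measurable borel" for z unfolding k_def by measurable
  have cayley: "norm ((z - \<i>) / (z + \<i>)) < 1" if "0 < Im z" for z
  proof -
    have "norm (z - \<i>) < norm (z + \<i>)" using norm_diff_less_norm_diff_cnj[OF that, of \<i>] by simp
    then show ?thesis by (auto simp: norm_divide divide_less_eq)
  qed
  have ki: "integrable M (k z)" if z: "0 < Im z" for z
  proof (rule M.integrable_const_bound)
    show "AE t in M. norm (k z t) \<le> 2 / (1 - norm ((z - \<i>) / (z + \<i>)))"
      using Schwarz_kernel_bound[OF cayley[OF z]]
      unfolding nevanlinna_kernel[OF z] k_def X_def by (intro AE_I2)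
  qed simp
  have repG: "\<i> * G z = \<i> * Re (G \<i>) + B * (LINT t|M. k z t)" if z: "0 < Im z" for z
  proof -
    have "z + \<i> \<noteq> 0" using z by (auto simp: complex_eq_iff)
    then have "\<i> * (1 + (z - \<i>) / (z + \<i>)) / (1 - (z - \<i>) / (z + \<i>)) = z"
      by (simp add: divide_simps)
    then have "f ((z - \<i>) / (z + \<i>)) = \<i> * G z" by (simp add: f_def)
    then show ?thesis
      using rep[OF cayley[OF z]] unfolding nevanlinna_kernel[OF z] k_def X_def f0 by simp
  qed
  define Y where "Y n = \<i> * of_real (real (Suc n))" for n
  have Y: "0 < Im (Y n)" "Im (Y n) = real (Suc n)" for n by (simp_all add: Y_def)
  have limY: "(\<lambda>n. Y n * G (Y n)) \<longlonglongrightarrow> 1"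
    unfolding Y_def
    by (rule filterlim_compose[OF lim filterlim_compose[OF filterlim_real_sequentially filterlim_Suc]])
  \<comment> \<open>With \<open>y = Suc n\<close> this is
    \<open>y\<^sup>2 * (1 + X\<^sup>2) / (y\<^sup>2 + X\<^sup>2)\<close> off the boundary point 1,
    increasing to \<open>1 + X\<^sup>2\<close>, and \<open>y\<^sup>2\<close> at that point. Its
    integral is \<open>Re (Y n * G (Y n)) / B\<close>, which the growth condition controls.\<close>
  define h where "h n t = real (Suc n) * Re (k (Y n) t)" for n t
  have hm [measurable]: "h n \<in> borel_measurable borel" for n unfolding h_def by measurable
  have hi: "integrable M (h n)" for n
    unfolding h_def using ki[OF Y(1)] by (intro integrable_mult_right integrable_Re)
  have h: "h n t = (if unit_circle t = 1 then (real (Suc n))\<^sup>2 else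
      (real (Suc n))\<^sup>2 * (1 + (X t)\<^sup>2) / ((real (Suc n))\<^sup>2 + (X t)\<^sup>2))" for n t
  proof -
    have "Re (\<i> * (complex_of_real a / (\<i> * of_real y - of_real x) + of_real x)) = a * y / (y\<^sup>2 + x\<^sup>2)" for a x y
      by (simp add: Re_divide power2_eq_square algebra_simps)
    from this[of "1 + (X t)\<^sup>2" "real (Suc n)" "X t"] show ?thesis
      unfolding h_def k_def Y_def by (simp add: power2_eq_square mult_ac del: of_nat_Suc)
  qed
  have h0: "0 \<le> h n t" for n t by (simp add: h)
  have hint: "B * (LINT t|M. h n t) = Re (Y n * G (Y n))" for n
  proof -
    have "Re (LINT t|M. k (Y n) t) = (LINT t|M. Re (k (Y n) t))" using ki[OF Y(1)] by simp
    then have "Re (\<i> * G (Y n)) = B * (LINT t|M. Re (k (Y n) t))" by (simp add: repG[OF Y(1)])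
    then have "B * (LINT t|M. Re (k (Y n) t)) = - Im (G (Y n))" by simp
    then have "B * (LINT t|M. h n t) = real (Suc n) * (- Im (G (Y n)))"
      unfolding h_def integral_mult_right_zero mult.left_commute[of B] by (simp only:)
    also have "\<dots> = Re (Y n * G (Y n))" by (simp add: Y_def)
    finally show ?thesis .
  qed
  have hlim: "(\<lambda>n. LINT t|M. h n t) \<longlonglongrightarrow> 1 / B"
  proof -
    have "(\<lambda>n. Re (Y n * G (Y n)) / B) \<longlonglongrightarrow> Re 1 / B" by (intro tendsto_intros limY) (use B in auto)
    moreover have "Re (Y n * G (Y n)) / B = (LINT t|M. h n t)" for n
      using hint[of n] B by (simp add: field_simps)
    ultimately show ?thesis by simp
  qed
  define S where "S = {t. unit_circle t = 1}"
  have S [measurable]: "S \<in> sets borel" unfolding S_def by measurable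
  \<comment> \<open>On \<open>S\<close> the integrand grows like \<open>(Suc n)\<^sup>2\<close>
    while the integrals converge; this leaves no mass for \<open>S\<close>.\<close>
  have "M.prob S = 0"
  proof (rule LIMSEQ_unique)
    have "(\<lambda>n. (LINT t|M. h n t) / (real (Suc n))\<^sup>2) \<longlonglongrightarrow> 0"
      by (rule tendsto_divide_0[OF hlim], rule filterlim_at_top_imp_at_infinity) real_asymp
    then show "(\<lambda>n. M.prob S) \<longlonglongrightarrow> 0"
    proof (rule tendsto_sandwich[OF _ _ tendsto_const, rotated 2])
      have "M.prob S \<le> (LINT t|M. h n t) / (real (Suc n))\<^sup>2" for n
      proof -
        have "(real (Suc n))\<^sup>2 * M.prob S = (LINT t|M. (real (Suc n))\<^sup>2 * indicator S t)" by simp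
        also have "\<dots> \<le> (LINT t|M. h n t)"
        proof (rule integral_mono[OF _ hi])
          show "(real (Suc n))\<^sup>2 * indicator S t \<le> h n t" for t
            using h0[of n t] by (auto simp: S_def h indicator_def simp del: of_nat_Suc)
        qed (rule integrable_mult_right, rule integrable_real_indicator, use S in \<open>simp_all add: M.emeasure_eq_measure\<close>)
        finally show ?thesis by (simp add: field_simps del: of_nat_Suc)
      qed
      then show "\<forall>\<^sub>F n in sequentially. M.prob S \<le> (LINT t|M. h n t) / (real (Suc n))\<^sup>2" by auto
    qed auto
  qed simp
  then have "AE t in M. t \<notin> S"
    by (simp add: AE_iff_measurable[of S] M.emeasure_eq_measure)
  then have AE: "AE t in M. unit_circle t \<noteq> 1" by (simp add: S_def)
  have hmono: "AE t in M. mono (\<lambda>n. h n t)"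
    using AE
  proof eventually_elim
    case (elim t)
    have "a * (1 + x) / (a + x) \<le> b * (1 + x) / (b + x)" if "0 < a" "a \<le> b" "0 \<le> x" for a b x :: real
      using that mult_right_mono[of a b x] mult_right_mono[of "a * x" "b * x" x]
      by (simp add: divide_simps) (simp add: algebra_simps)
    then show ?case using elim by (intro monoI) (simp add: h power_mono)
  qed
  have hpt: "AE t in M. (\<lambda>n. h n t) \<longlonglongrightarrow> 1 + (X t)\<^sup>2"
    using AE
  proof eventually_elim
    case (elim t)
    have "(\<lambda>n. (real (Suc n))\<^sup>2 * (1 + x) / ((real (Suc n))\<^sup>2 + x)) \<longlonglongrightarrow> 1 + x" for x :: real
      by real_asymp
    then show ?case using elim by (simp add: h del: of_nat_Suc)
  qed
  \<comment> \<open>Monotone convergence gives not only integrability but the exact value, so that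
    \<open>B * (1 + X\<^sup>2)\<close> is a probability density.\<close>
  have X2: "integrable M (\<lambda>t. 1 + (X t)\<^sup>2)" "(LINT t|M. 1 + (X t)\<^sup>2) = 1 / B"
    by (rule integral_monotone_convergence_nonneg[OF hi hmono _ hpt hlim]; simp add: h0)+
  define N where "N = density M (\<lambda>t. B * (1 + (X t)\<^sup>2))"
  interpret N: prob_space N
    unfolding N_def by (rule prob_space_density) (use X2 B in auto)
  define \<nu> where "\<nu> = distr N borel X"
  have XN [measurable]: "X \<in> measurable N borel" by (simp add: N_def)
  interpret \<nu>: prob_space \<nu> unfolding \<nu>_def by (rule N.prob_space_distr) simp
  interpret \<nu>: real_distribution \<nu> by standard (simp add: \<nu>_def)
  have Xi: "integrable M X"
  proof (rule Bochner_Integration.integrable_bound[OF X2(1)])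
    have "\<bar>x\<bar> \<le> 1 + x\<^sup>2" for x :: real
      using zero_le_power2[of "\<bar>x\<bar> - 1"] by (simp add: power2_diff)
    then show "AE t in M. norm (X t) \<le> norm (1 + (X t)\<^sup>2)" by (auto simp: abs_of_nonneg)
  qed simp
  \<comment> \<open>Separating the constant term \<open>X\<close> of the kernel leaves a real
    constant besides the Cauchy transform. It must vanish because \<open>\<i> * y\<close> times
    either function tends to 1.\<close>
  define c where "c = complex_of_real (Re (G \<i>) + B * (LINT t|M. X t))"
  have GN: "G z = c + cauchy_transform \<nu> z" if z: "0 < Im z" for z
  proof -
    let ?q = "\<lambda>t. (1 + of_real ((X t)\<^sup>2)) / (z - complex_of_real (X t))"
    have "cauchy_transform \<nu> z = (LINT t|N. 1 / (z - complex_of_real (X t)))"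
      unfolding cauchy_transform_def \<nu>_def by (rule integral_distr) simp_all
    also have "\<dots> = (LINT t|M. (B * (1 + (X t)\<^sup>2)) *\<^sub>R (1 / (z - complex_of_real (X t))))"
      unfolding N_def using B by (intro integral_density) auto
    also have "\<dots> = (LINT t|M. B * ?q t)"
      by (intro Bochner_Integration.integral_cong) (auto simp: scaleR_conv_of_real)
    also have "\<dots> = B * (LINT t|M. ?q t)" by (rule integral_mult_right_zero)
    finally have C: "cauchy_transform \<nu> z = B * (LINT t|M. ?q t)" .
    have qi: "integrable M ?q"
    proof (rule Bochner_Integration.integrable_bound[OF integrable_mult_right[OF X2(1), of "1 / Im z"]])
      have "norm (?q t) \<le> 1 / Im z * (1 + (X t)\<^sup>2)" for t
      proof -
        have "?q t = (1 / (z - complex_of_real (X t))) * of_real (1 + (X t)\<^sup>2)" by simp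
        then have "norm (?q t) = norm (1 / (z - complex_of_real (X t))) * (1 + (X t)\<^sup>2)"
          by (metis (no_types, lifting) norm_mult norm_of_real abs_of_nonneg add_nonneg_nonneg zero_le_one zero_le_power2)
        also have "\<dots> \<le> 1 / Im z * (1 + (X t)\<^sup>2)"
          by (intro mult_right_mono norm_inverse_diff_real) (use z in auto)
        finally show ?thesis .
      qed
      then show "AE t in M. norm (?q t) \<le> norm (1 / Im z * (1 + (X t)\<^sup>2))"
        by (intro AE_I2) (smt (verit, best) real_norm_def)
    qed simp
    have "(LINT t|M. k z t) = (LINT t|M. \<i> * (?q t + of_real (X t)))"
      by (rule integral_cong_AE) (use AE in \<open>auto simp: k_def elim!: eventually_mono\<close>)
    also have "\<dots> = \<i> * ((LINT t|M. ?q t) + of_real (LINT t|M. X t))"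
      using qi Xi by (subst integral_mult_right_zero) simp
    finally have "\<i> * G z = \<i> * (c + cauchy_transform \<nu> z)"
      unfolding repG[OF z] C c_def by (simp add: algebra_simps)
    then show ?thesis by simp
  qed
  have "((\<lambda>y. \<i> * of_real y * cauchy_transform \<nu> (\<i> * of_real y)) \<longlongrightarrow> 1) at_top"
    by (rule filterlim_compose[OF \<nu>.cauchy_transform_nontangential filterlim_nontangential_imaginary_axis[of 1]]) simp
  from tendsto_diff[OF lim this]
  have "((\<lambda>y. \<i> * of_real y * c) \<longlongrightarrow> 1 - 1) at_top"
    by (rule Lim_transform_eventually[OF _ eventually_mono[OF eventually_gt_at_top[of 0]]])
       (simp add: GN algebra_simps)
  then have 0: "((\<lambda>y. norm (\<i> * of_real y * c)) \<longlongrightarrow> 0) at_top"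
    by (intro tendsto_norm_zero) simp
  have "norm c \<le> 0"
  proof (rule tendsto_lowerbound[OF 0])
    show "\<forall>\<^sub>F y in at_top. norm c \<le> norm (\<i> * of_real y * c)"
      using eventually_ge_at_top[of 1]
      by eventually_elim (use mult_right_mono[of 1 _ "norm c"] in \<open>auto simp: norm_mult\<close>)
  qed simp
  then have "c = 0" by simp
  then show ?thesis using GN \<nu>.real_distribution_axioms by auto
qed

section \<open>Monotone convolution and selfdecomposability\<close>

lemma real_distribution_dilation: "real_distribution \<mu> \<Longrightarrow> real_distribution (dilation c \<mu>)"
  unfolding dilation_def
  by (rule prob_space.real_distribution_distr)
     (auto simp: real_distribution_def real_distribution_axioms_def cong: measurable_cong_sets)

lemma F_transform_dilation:
  assumes \<mu>: "real_distribution \<mu>" and c: "0 < c"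
  shows "F_transform (dilation c \<mu>) z = c * F_transform \<mu> (z / c)"
proof -
  interpret real_distribution \<mu> by fact
  have "cauchy_transform (dilation c \<mu>) z = (LINT x|\<mu>. 1 / (z - complex_of_real (c * x)))"
    unfolding cauchy_transform_def dilation_def by (rule integral_distr) simp_all
  also have "\<dots> = (LINT x|\<mu>. (1 / c) * (1 / (z / c - complex_of_real x)))"
  proof (rule Bochner_Integration.integral_cong[OF refl])
    fix x
    have "z - complex_of_real (c * x) = c * (z / c - complex_of_real x)" using c by (simp add: field_simps)
    then show "1 / (z - complex_of_real (c * x)) = (1 / c) * (1 / (z / c - complex_of_real x))"
      by simp
  qed
  also have "\<dots> = (1 / c) * cauchy_transform \<mu> (z / c)"
    unfolding cauchy_transform_def by (rule integral_mult_right_zero)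
  finally show ?thesis by (simp add: F_transform_def)
qed

lemma F_transform_unique:
  assumes "real_distribution \<mu>" "real_distribution \<nu>"
    and "\<And>z. 0 < Im z \<Longrightarrow> F_transform \<mu> z = F_transform \<nu> z"
  shows "\<mu> = \<nu>"
  using assms by (intro cauchy_transform_unique) (auto simp: F_transform_def)

text \<open>\<open>N\<close> need not preserve the imaginary axis, so composing limits requires a
  cone: eventually \<open>norm (N (\<i> * y))\<close> is at most \<open>2 * y\<close>, which is at
  most twice the imaginary part of \<open>N (\<i> * y)\<close>.\<close>

lemma filterlim_nontangential_of_asymptotics:
  assumes "\<And>y. 0 < y \<Longrightarrow> y \<le> Im (N (\<i> * of_real y))"
    and "((\<lambda>y. N (\<i> * of_real y) / (\<i> * of_real y)) \<longlongrightarrow> 1) at_top"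
  shows "filterlim (\<lambda>y. N (\<i> * of_real y)) (nontangential 2) at_top"
  unfolding filterlim_iff eventually_nontangential
proof (intro allI impI, elim exE conjE)
  fix P R assume R: "0 < R" and P: "\<forall>z. R \<le> Im z \<longrightarrow> norm z \<le> 2 * Im z \<longrightarrow> P z"
  have "\<forall>\<^sub>F y in at_top. norm (N (\<i> * of_real y) / (\<i> * of_real y)) < 2"
    using order_tendstoD(2)[OF tendsto_norm[OF assms(2)], of 2] by simp
  then show "\<forall>\<^sub>F y in at_top. P (N (\<i> * of_real y))"
    using eventually_ge_at_top[of R]
  proof eventually_elim
    case (elim y)
    have y: "0 < y" "R \<le> y" using elim R by auto
    have "norm (N (\<i> * of_real y)) \<le> 2 * y"
      using elim(1) y by (simp add: norm_divide norm_mult divide_less_eq)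
    then show ?case using P assms(1)[OF y(1)] y by force
  qed
qed

lemma F_transform_representation:
  assumes N: "N holomorphic_on upper_half_plane" and pos: "\<And>z. 0 < Im z \<Longrightarrow> 0 < Im (N z)"
    and lim: "((\<lambda>y. N (\<i> * of_real y) / (\<i> * of_real y)) \<longlongrightarrow> 1) at_top"
  shows "\<exists>\<nu>. real_distribution \<nu> \<and> (\<forall>z. 0 < Im z \<longrightarrow> F_transform \<nu> z = N z)"
proof -
  have nz: "N z \<noteq> 0" if "0 < Im z" for z using pos[OF that] by auto
  have "\<exists>\<nu>. real_distribution \<nu> \<and> (\<forall>z. 0 < Im z \<longrightarrow> cauchy_transform \<nu> z = 1 / N z)"
  proof (rule cauchy_transform_representation)
    show "(\<lambda>z. 1 / N z) holomorphic_on upper_half_plane"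
      by (intro holomorphic_intros N) (use nz in auto)
    show "Im (1 / N z) \<le> 0" if "0 < Im z" for z
      using pos[OF that] by (simp add: Im_divide)
    show "((\<lambda>y. \<i> * of_real y * (1 / N (\<i> * of_real y))) \<longlongrightarrow> 1) at_top"
      using tendsto_inverse[OF lim] by simp
  qed
  then show ?thesis by (auto simp: F_transform_def)
qed

lemma F_transform_imaginary_axis:
  assumes "real_distribution \<mu>"
  shows "((\<lambda>y. F_transform \<mu> (\<i> * of_real y) / (\<i> * of_real y)) \<longlongrightarrow> 1) at_top"
  by (rule filterlim_compose[OF real_distribution.F_transform_nontangential[OF assms]
        filterlim_nontangential_imaginary_axis[of 1]]) simp

lemma monotone_convolution_eqI:
  assumes "real_distribution \<rho>"
    and "\<And>z. 0 < Im z \<Longrightarrow> F_transform \<rho> z = F_transform \<mu> (F_transform \<nu> z)"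
  shows "\<mu> \<rhd>\<^sub>m \<nu> = \<rho>"
  unfolding monotone_convolution_def
  by (rule the_equality) (use assms in \<open>auto intro!: F_transform_unique\<close>)

lemma monotone_convolution_exists:
  assumes \<mu>: "real_distribution \<mu>" and \<nu>: "real_distribution \<nu>"
  shows "\<exists>\<rho>. real_distribution \<rho> \<and>
    (\<forall>z. 0 < Im z \<longrightarrow> F_transform \<rho> z = F_transform \<mu> (F_transform \<nu> z))"
proof (rule F_transform_representation)
  interpret \<mu>: real_distribution \<mu> by fact
  interpret \<nu>: real_distribution \<nu> by fact
  show "(\<lambda>z. F_transform \<mu> (F_transform \<nu> z)) holomorphic_on upper_half_plane"
    by (rule holomorphic_on_compose_gen[OF \<nu>.holomorphic_F_transform \<mu>.holomorphic_F_transform, unfolded comp_def])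
       (auto simp: \<nu>.Im_F_transform_pos)
  show "0 < Im (F_transform \<mu> (F_transform \<nu> z))" if "0 < Im z" for z
    using that by (intro \<mu>.Im_F_transform_pos \<nu>.Im_F_transform_pos)
  have "filterlim (\<lambda>y. F_transform \<nu> (\<i> * of_real y)) (nontangential 2) at_top"
    using \<nu>.Im_F_transform_ge[of "\<i> * of_real _"] F_transform_imaginary_axis[OF \<nu>]
    by (intro filterlim_nontangential_of_asymptotics) auto
  from tendsto_mult[OF filterlim_compose[OF \<mu>.F_transform_nontangential this] F_transform_imaginary_axis[OF \<nu>]]
  have "((\<lambda>y. F_transform \<mu> (F_transform \<nu> (\<i> * of_real y)) / F_transform \<nu> (\<i> * of_real y) *
      (F_transform \<nu> (\<i> * of_real y) / (\<i> * of_real y))) \<longlongrightarrow> 1) at_top" by simp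
  moreover have "\<forall>\<^sub>F y in at_top. F_transform \<mu> (F_transform \<nu> (\<i> * of_real y)) / F_transform \<nu> (\<i> * of_real y) *
      (F_transform \<nu> (\<i> * of_real y) / (\<i> * of_real y)) =
      F_transform \<mu> (F_transform \<nu> (\<i> * of_real y)) / (\<i> * of_real y)"
    using eventually_gt_at_top[of 0]
    by eventually_elim (use \<nu>.F_transform_nonzero[of "\<i> * of_real _"] in simp)
  ultimately show "((\<lambda>y. F_transform \<mu> (F_transform \<nu> (\<i> * of_real y)) / (\<i> * of_real y)) \<longlongrightarrow> 1) at_top"
    by (rule Lim_transform_eventually)
qed

lemma F_transform_monotone_convolution:
  assumes "real_distribution \<mu>" "real_distribution \<nu>" "0 < Im z"
  shows "F_transform (\<mu> \<rhd>\<^sub>m \<nu>) z = F_transform \<mu> (F_transform \<nu> z)"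
  using monotone_convolution_exists[OF assms(1,2)] monotone_convolution_eqI[of _ \<mu> \<nu>] assms(3) by blast

text \<open>A form of Harnack's inequality, deduced from the Schwarz--Pick lemma.\<close>

lemma upper_half_plane_self_map_bound:
  assumes z0: "0 < Im z0" and z: "0 < Im z"
  shows "\<exists>K. \<forall>h. h holomorphic_on upper_half_plane \<longrightarrow> (\<forall>w. 0 < Im w \<longrightarrow> 0 < Im (h w)) \<longrightarrow>
    norm (h z) \<le> K * norm (h z0)"
proof -
  define \<rho> where "\<rho> = norm ((z - z0) / (z - cnj z0))"
  have zc: "z - cnj z0 \<noteq> 0" using z z0 by (auto simp: complex_eq_iff)
  have \<rho>: "0 \<le> \<rho>" "\<rho> < 1"
    using norm_diff_less_norm_diff_cnj[OF z z0] zc by (auto simp: \<rho>_def norm_divide)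
  \<comment> \<open>Schwarz--Pick bounds \<open>norm (h z - w0)\<close> by
    \<open>\<rho> * norm (h z - cnj w0)\<close>, hence by
    \<open>\<rho> * (norm (h z - w0) + 2 * norm w0)\<close>; solving for
    \<open>norm (h z - w0)\<close> gives the constant, which depends only on the two points.\<close>
  have "norm (h z) \<le> (1 + 2 * \<rho> / (1 - \<rho>)) * norm (h z0)"
    if h: "h holomorphic_on upper_half_plane" and pos: "\<And>w. 0 < Im w \<Longrightarrow> 0 < Im (h w)" for h
  proof -
    define w0 where "w0 = h z0"
    have w0: "0 < Im w0" unfolding w0_def by (rule pos[OF z0])
    \<comment> \<open>\<open>\<phi>\<close> is inverse to
      \<open>z \<mapsto> (z - z0) / (z - cnj z0)\<close>. Written as an affine image of the Cayley
      map, it visibly takes values in the half-plane; \<open>k\<close> below is \<open>h\<close>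
      transported to a self-map of the disc fixing 0.\<close>
    define \<phi> where "\<phi> \<zeta> = of_real (Re z0) + of_real (Im z0) * (\<i> * (1 + \<zeta>) / (1 - \<zeta>))" for \<zeta>
    have \<phi>: "0 < Im (\<phi> \<zeta>)" if "norm \<zeta> < 1" for \<zeta>
      using Im_cayley[OF that] z0 by (simp add: \<phi>_def del: times_divide_eq_right)
    have "z0 = of_real (Re z0) + \<i> * of_real (Im z0)" by (simp add: complex_eq_iff)
    then have \<phi>_eq: "\<phi> \<zeta> = (z0 - cnj z0 * \<zeta>) / (1 - \<zeta>)" if "\<zeta> \<noteq> 1" for \<zeta>
    proof -
      have "(z0 - cnj z0 * \<zeta>) = of_real (Re z0) * (1 - \<zeta>) + of_real (Im z0) * (\<i> * (1 + \<zeta>))"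
        by (simp add: complex_eq_iff algebra_simps)
      then show ?thesis using that by (simp add: \<phi>_def add_divide_distrib)
    qed
    have \<phi>0: "\<phi> 0 = z0" by (simp add: \<phi>_eq)
    define k where "k \<zeta> = (h (\<phi> \<zeta>) - w0) / (h (\<phi> \<zeta>) - cnj w0)" for \<zeta>
    have hc: "h v - cnj w0 \<noteq> 0" if "0 < Im v" for v
      using pos[OF that] w0 by (auto simp: complex_eq_iff)
    have "\<phi> holomorphic_on ball 0 1"
      unfolding \<phi>_def by (intro holomorphic_intros) auto
    then have "(\<lambda>\<zeta>. h (\<phi> \<zeta>)) holomorphic_on ball 0 1"
      by (rule holomorphic_on_compose_gen[OF _ h, unfolded comp_def]) (use \<phi> in auto)
    then have "k holomorphic_on ball 0 1"
      unfolding k_def by (intro holomorphic_intros) (use hc[OF \<phi>] in auto)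
    moreover have "k 0 = 0" by (simp add: k_def \<phi>0 w0_def)
    moreover have "norm (k \<zeta>) < 1" if "norm \<zeta> < 1" for \<zeta>
      using norm_diff_less_norm_diff_cnj[OF pos[OF \<phi>[OF that]] w0] hc[OF \<phi>[OF that]]
      by (simp add: k_def norm_divide)
    moreover have "norm ((z - z0) / (z - cnj z0)) < 1" using \<rho>(2) by (simp add: \<rho>_def)
    ultimately have "norm (k ((z - z0) / (z - cnj z0))) \<le> \<rho>"
      unfolding \<rho>_def by (rule Schwarz_Lemma(1))
    moreover have "\<phi> ((z - z0) / (z - cnj z0)) = z"
    proof -
      have ne: "(z - z0) / (z - cnj z0) \<noteq> 1"
      proof
        assume "(z - z0) / (z - cnj z0) = 1"
        then have "z - z0 = z - cnj z0" using zc by simp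
        then show False using z0 by (simp add: complex_eq_iff)
      qed
      have "z0 - cnj z0 \<noteq> 0" using z0 by (auto simp: complex_eq_iff)
      moreover have "z0 - cnj z0 * ((z - z0) / (z - cnj z0)) = z * (z0 - cnj z0) / (z - cnj z0)"
        using zc by (simp add: field_simps)
      moreover have "1 - (z - z0) / (z - cnj z0) = (z0 - cnj z0) / (z - cnj z0)"
        using zc by (simp add: field_simps)
      ultimately show ?thesis using zc unfolding \<phi>_eq[OF ne] by simp
    qed
    ultimately have "norm (h z - w0) \<le> \<rho> * norm (h z - cnj w0)"
      using hc[OF z] by (simp add: k_def norm_divide divide_le_eq)
    also have "norm (h z - cnj w0) \<le> norm (h z - w0) + 2 * norm w0"
      using norm_triangle_ineq[of "h z - w0" "w0 - cnj w0"] norm_triangle_ineq4[of w0 "cnj w0"] by simp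
    then have "\<rho> * norm (h z - cnj w0) \<le> \<rho> * (norm (h z - w0) + 2 * norm w0)"
      using \<rho>(1) by (rule mult_left_mono)
    finally have "(1 - \<rho>) * norm (h z - w0) \<le> 2 * \<rho> * norm w0"
      by (simp add: algebra_simps)
    then have "norm (h z - w0) \<le> 2 * \<rho> / (1 - \<rho>) * norm w0"
      using \<rho> by (simp add: field_simps)
    then show ?thesis
      using norm_triangle_sub[of "h z" w0] by (simp add: w0_def algebra_simps)
  qed
  then show ?thesis by blast
qed

section \<open>From selfdecomposability to the sign of the logarithmic derivative\<close>

context real_distribution
begin

lemma F_transform_expanding:
  "\<exists>R>0. \<forall>z w. R \<le> Im z \<longrightarrow> R \<le> Im w \<longrightarrow> norm z \<le> 2 * Im z \<longrightarrow> norm w \<le> 2 * Im w \<longrightarrow>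
    norm (z - w) \<le> 2 * norm (F_transform M z - F_transform M w)"
proof -
  have "\<forall>\<^sub>F z in nontangential 2. dist (deriv (F_transform M) z) 1 < 1 / 2"
    using deriv_F_transform_nontangential by (rule tendstoD) simp
  then obtain R where R: "0 < R" and
    dist: "\<And>z. R \<le> Im z \<Longrightarrow> norm z \<le> 2 * Im z \<Longrightarrow> dist (deriv (F_transform M) z) 1 < 1 / 2"
    unfolding eventually_nontangential by blast
  define S where "S = {z. R \<le> Im z \<and> norm z \<le> 2 * Im z}"
  have "convex S"
  proof (rule convexI)
    fix x y :: complex and u v :: real
    assume xy: "x \<in> S" "y \<in> S" and uv: "0 \<le> u" "0 \<le> v" "u + v = 1"
    have "norm (u *\<^sub>R x + v *\<^sub>R y) \<le> u * norm x + v * norm y"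
      using norm_triangle_ineq[of "u *\<^sub>R x" "v *\<^sub>R y"] uv by simp
    also have "\<dots> \<le> u * (2 * Im x) + v * (2 * Im y)"
      using xy uv by (intro add_mono mult_left_mono) (auto simp: S_def)
    finally have "norm (u *\<^sub>R x + v *\<^sub>R y) \<le> 2 * Im (u *\<^sub>R x + v *\<^sub>R y)" by simp
    moreover have "u * R + v * R \<le> u * Im x + v * Im y"
      using xy uv by (intro add_mono mult_left_mono) (auto simp: S_def)
    then have "R \<le> Im (u *\<^sub>R x + v *\<^sub>R y)" using uv(3) by (simp flip: distrib_right)
    ultimately show "u *\<^sub>R x + v *\<^sub>R y \<in> S" by (simp add: S_def)
  qed
  have "norm (z - w) \<le> 2 * norm (F_transform M z - F_transform M w)" if "z \<in> S" "w \<in> S" for z w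
  proof -
    have "norm ((F_transform M z - z) - (F_transform M w - w)) \<le> 1 / 2 * norm (z - w)"
    proof (rule field_differentiable_bound[OF \<open>convex S\<close> _ _ that(1,2)])
      fix v assume v: "v \<in> S"
      then have "0 < Im v" using R by (auto simp: S_def)
      then have "(F_transform M has_field_derivative deriv (F_transform M) v) (at v)"
        by (rule has_field_derivative_F_transform)
      then show "((\<lambda>v. F_transform M v - v) has_field_derivative deriv (F_transform M) v - 1) (at v within S)"
        by (auto intro!: derivative_intros intro: has_field_derivative_at_within)
      show "norm (deriv (F_transform M) v - 1) \<le> 1 / 2"
        using dist[of v] v by (auto simp: S_def dist_norm)
    qed
    then show ?thesis
      using norm_triangle_ineq2[of "z - w" "- (F_transform M z - z - (F_transform M w - w))"]
      by (simp add: norm_minus_commute algebra_simps)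
  qed
  then show ?thesis using R by (auto simp: S_def)
qed

lemma norm_F_transform_imaginary_axis_le: "\<exists>R>0. \<forall>y\<ge>R. norm (F_transform M (\<i> * of_real y)) \<le> 2 * y"
proof -
  have "\<forall>\<^sub>F y in at_top. norm (F_transform M (\<i> * of_real y) / (\<i> * of_real y)) < 2"
    using order_tendstoD(2)[OF tendsto_norm[OF F_transform_imaginary_axis[OF real_distribution_axioms]], of 2]
    by simp
  then obtain R where R: "\<And>y. R \<le> y \<Longrightarrow> norm (F_transform M (\<i> * of_real y) / (\<i> * of_real y)) < 2"
    by (auto simp: eventually_at_top_linorder)
  have "norm (F_transform M (\<i> * of_real y)) \<le> 2 * y" if "max 1 R \<le> y" for y
    using R[of y] that by (simp add: norm_divide norm_mult divide_less_eq)
  then show ?thesis by (intro exI[of _ "max 1 R"]) auto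
qed

text \<open>For \<open>c = 1 / (1 + s)\<close> the decomposition reads
  \<open>F z = c * F (F_transform \<nu> z / c)\<close>, so
  \<open>w = (1 + s) * F_transform \<nu>\<close> solves the functional equation. Its growth and its
  asymptotics are those of an F-transform, scaled.\<close>

lemma selfdecomposable_self_map:
  assumes a: "monotonically_selfdecomposable M" and s: "0 < s"
  shows "\<exists>w. w holomorphic_on upper_half_plane \<and>
    (\<forall>z. 0 < Im z \<longrightarrow> (1 + s) * Im z \<le> Im (w z) \<and> F_transform M (w z) = (1 + s) * F_transform M z) \<and>
    ((\<lambda>y. w (\<i> * of_real y) / (\<i> * of_real y)) \<longlongrightarrow> 1 + s) at_top"
proof -
  define c where "c = 1 / (1 + s)"
  have c: "0 < c" "c < 1" "1 / c = 1 + s" using s by (auto simp: c_def)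
  then obtain \<nu> where \<nu>: "real_distribution \<nu>" and eq: "M = dilation c M \<rhd>\<^sub>m \<nu>"
    using a[unfolded monotonically_selfdecomposable_def, THEN bspec[of _ _ c]] by auto
  interpret \<nu>: real_distribution \<nu> by fact
  define w where "w z = (1 + s) * F_transform \<nu> z" for z
  have w: "w z = F_transform \<nu> z / c" for z by (simp add: w_def c_def)
  have cF: "F_transform M z = c * F_transform M (w z)" if "0 < Im z" for z
    using F_transform_monotone_convolution[OF real_distribution_dilation[OF real_distribution_axioms, of c] \<nu> that]
      F_transform_dilation[OF real_distribution_axioms c(1)]
    by (simp add: w flip: eq)
  have F: "F_transform M (w z) = (1 + of_real s) * F_transform M z" if "0 < Im z" for z
  proof -
    have "1 + complex_of_real s \<noteq> 0" using s by (auto simp: complex_eq_iff)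
    then have "(1 + complex_of_real s) * complex_of_real c = 1" by (simp add: c_def)
    then have "F_transform M (w z) = (1 + complex_of_real s) * (c * F_transform M (w z))"
      by (simp flip: mult.assoc)
    then show ?thesis by (simp flip: cF[OF that])
  qed
  have 1: "w holomorphic_on upper_half_plane"
    unfolding w_def by (intro holomorphic_intros \<nu>.holomorphic_F_transform)
  have 2: "(1 + s) * Im z \<le> Im (w z)" if "0 < Im z" for z
    using \<nu>.Im_F_transform_ge[OF that] s by (simp add: w_def)
  have 3: "((\<lambda>y. w (\<i> * of_real y) / (\<i> * of_real y)) \<longlongrightarrow> 1 + of_real s) at_top"
    using tendsto_mult[OF tendsto_const[of "1 + of_real s"] F_transform_imaginary_axis[OF \<nu>]]
    by (simp add: w_def)
  show ?thesis by (intro exI[of _ w] conjI allI impI 1 2 3 F)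
qed

text \<open>The expansion property identifies \<open>w\<close> with a small perturbation of the identity as long as
  \<open>w\<close> stays in the nontangential region; an intermediate value argument coming from \<open>\<i>\<infinity>\<close> shows that
  it does.\<close>

lemma self_map_displacement_bound:
  "\<exists>R>0. \<forall>s w. 0 < s \<longrightarrow> s < 1 / 16 \<longrightarrow> w holomorphic_on upper_half_plane \<longrightarrow>
    (\<forall>z. 0 < Im z \<longrightarrow> F_transform M (w z) = (1 + s) * F_transform M z) \<longrightarrow>
    ((\<lambda>y. w (\<i> * of_real y) / (\<i> * of_real y)) \<longlongrightarrow> 1 + s) at_top \<longrightarrow>
    norm (w (\<i> * of_real R) - \<i> * of_real R) \<le> 4 * s * R"
proof -
  obtain R1 where R1: "0 < R1" and exp: "\<And>z w. R1 \<le> Im z \<Longrightarrow> R1 \<le> Im w \<Longrightarrow> norm z \<le> 2 * Im z \<Longrightarrow>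
      norm w \<le> 2 * Im w \<Longrightarrow> norm (z - w) \<le> 2 * norm (F_transform M z - F_transform M w)"
    using F_transform_expanding by blast
  obtain R2 where R2: "0 < R2" "\<And>y. R2 \<le> y \<Longrightarrow> norm (F_transform M (\<i> * of_real y)) \<le> 2 * y"
    using norm_F_transform_imaginary_axis_le by blast
  \<comment> \<open>The factor 2 leaves room for a displacement of \<open>y / 4\<close>: for
    \<open>y\<close> beyond \<open>R\<close>, height \<open>3 / 4 * y\<close> is still above
    \<open>R1\<close>.\<close>
  define R where "R = max (2 * R1) R2"
  have R: "0 < R" "2 * R1 \<le> R" "R2 \<le> R" using R1 by (auto simp: R_def)
  have "norm (w (\<i> * of_real R) - \<i> * of_real R) \<le> 4 * s * R"
    if s: "0 < s" "s < 1 / 16" and w: "w holomorphic_on upper_half_plane"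
      and F: "\<And>z. 0 < Im z \<Longrightarrow> F_transform M (w z) = (1 + s) * F_transform M z"
      and lim: "((\<lambda>y. w (\<i> * of_real y) / (\<i> * of_real y)) \<longlongrightarrow> 1 + s) at_top" for s w
  proof -
    define q where "q y = norm (w (\<i> * of_real y) - \<i> * of_real y) / y" for y
    \<comment> \<open>Bootstrap: a relative displacement of at most 1/4 keeps
      \<open>w (\<i> * y)\<close> in the truncated cone, and the expansion property then improves it
      to \<open>4 * s\<close>. As \<open>s < 1 / 16\<close>, this is below 1/4, so the value 1/4 is
      never attained.\<close>
    have small: "q y \<le> 4 * s" if y: "R \<le> y" and q: "q y \<le> 1 / 4" for y
    proof -
      have y0: "0 < y" "R1 \<le> 3 / 4 * y" using y R R1 by auto
      have d: "norm (w (\<i> * of_real y) - \<i> * of_real y) \<le> y / 4"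
        using q y0 by (simp add: q_def field_simps)
      have Imw: "3 / 4 * y \<le> Im (w (\<i> * of_real y))"
        using abs_Im_le_cmod[of "w (\<i> * of_real y) - \<i> * of_real y"] d by simp
      have nw: "norm (w (\<i> * of_real y)) \<le> y + y / 4"
        using norm_triangle_sub[of "w (\<i> * of_real y)" "\<i> * of_real y"] d y0 by (simp add: norm_mult)
      have "norm (w (\<i> * of_real y) - \<i> * of_real y)
          \<le> 2 * norm (F_transform M (w (\<i> * of_real y)) - F_transform M (\<i> * of_real y))"
        by (rule exp) (use Imw nw y0 in \<open>auto simp: norm_mult\<close>)
      also have "F_transform M (w (\<i> * of_real y)) - F_transform M (\<i> * of_real y) =
          s * F_transform M (\<i> * of_real y)"
        using F[of "\<i> * of_real y"] y0 by (simp add: algebra_simps)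
      also have "norm \<dots> \<le> s * (2 * y)"
        unfolding norm_mult using R2(2)[of y] y R s by (intro mult_mono) auto
      finally have "norm (w (\<i> * of_real y) - \<i> * of_real y) \<le> 4 * s * y" by simp
      then show ?thesis using y0 by (simp add: q_def field_simps)
    qed
    have "q R \<le> 1 / 4"
    proof (rule ccontr)
      assume "\<not> q R \<le> 1 / 4"
      then have qR: "1 / 4 < q R" by simp
      have "((\<lambda>y. norm (w (\<i> * of_real y) / (\<i> * of_real y) - 1)) \<longlongrightarrow> norm (1 + of_real s - 1 :: complex)) at_top"
        by (intro tendsto_intros) (use lim in simp)
      then have "((\<lambda>y. norm (w (\<i> * of_real y) / (\<i> * of_real y) - 1)) \<longlongrightarrow> s) at_top"
        using s by simp
      then have "\<forall>\<^sub>F y in at_top. norm (w (\<i> * of_real y) / (\<i> * of_real y) - 1) < 1 / 4"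
        by (rule order_tendstoD(2)) (use s in simp)
      then have "\<forall>\<^sub>F y in at_top. q y < 1 / 4 \<and> R \<le> y"
        using eventually_ge_at_top[of R]
      proof eventually_elim
        case (elim y)
        then have y: "0 < y" using R by simp
        have "w (\<i> * of_real y) / (\<i> * of_real y) - 1 = (w (\<i> * of_real y) - \<i> * of_real y) / (\<i> * of_real y)"
          using y by (simp add: field_simps)
        then have "norm (w (\<i> * of_real y) / (\<i> * of_real y) - 1) = q y"
          using y by (simp add: q_def norm_divide norm_mult)
        then show ?case using elim by simp
      qed
      then obtain Y where Y: "q Y < 1 / 4" "R \<le> Y"
        using eventually_happens'[OF trivial_limit_at_top_linorder] by blast
      have "continuous_on {R..Y} q"
      proof -
        have "continuous_on {R..Y} (\<lambda>y. w (\<i> * of_real y))"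
          by (rule continuous_on_compose2[OF holomorphic_on_imp_continuous_on[OF w]])
             (use R in \<open>auto intro!: continuous_intros\<close>)
        then show ?thesis unfolding q_def using R by (intro continuous_intros) auto
      qed
      then obtain y where "R \<le> y" "q y = 1 / 4"
        using IVT2'[of q Y "1 / 4" R] qR Y by auto
      then show False using small[of y] s by simp
    qed
    from small[OF order_refl this] show ?thesis
      using R by (simp add: q_def field_simps)
  qed
  then show ?thesis using R(1) by blast
qed

lemma selfdecomposable_imp_Im_log_deriv:
  assumes a: "monotonically_selfdecomposable M" and z: "0 < Im z"
  shows "Im (deriv (F_transform M) z / F_transform M z) \<le> 0"
proof -
  obtain R where R: "0 < R" and bound: "\<And>s w. 0 < s \<Longrightarrow> s < 1 / 16 \<Longrightarrow> w holomorphic_on upper_half_plane \<Longrightarrow>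
    (\<And>z. 0 < Im z \<Longrightarrow> F_transform M (w z) = (1 + s) * F_transform M z) \<Longrightarrow>
    ((\<lambda>y. w (\<i> * of_real y) / (\<i> * of_real y)) \<longlongrightarrow> 1 + s) at_top \<Longrightarrow>
    norm (w (\<i> * of_real R) - \<i> * of_real R) \<le> 4 * s * R"
    using self_map_displacement_bound by blast
  obtain K where K: "\<And>h. h holomorphic_on upper_half_plane \<Longrightarrow> (\<And>w. 0 < Im w \<Longrightarrow> 0 < Im (h w)) \<Longrightarrow>
    norm (h z) \<le> K * norm (h (\<i> * of_real R))"
    using upper_half_plane_self_map_bound[of "\<i> * of_real R" z] R z by auto
  \<comment> \<open>The offset 17 makes every term satisfy the bound \<open>s < 1 / 16\<close> of
    the displacement estimate.\<close>
  define s where "s n = 1 / real (n + 17)" for n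
  have s: "0 < s n" "s n < 1 / 16" for n by (auto simp: s_def field_simps)
  have s0: "s \<longlonglongrightarrow> 0" unfolding s_def by real_asymp
  have "\<exists>g::complex. 0 < Im g \<and> norm g \<le> \<bar>K\<bar> * (4 * R) \<and> F_transform M (z + s n * g) = (1 + of_real (s n)) * F_transform M z" for n
  proof -
    from selfdecomposable_self_map[OF a s(1)[of n]] obtain w where w: "w holomorphic_on upper_half_plane"
      and w': "\<forall>z. 0 < Im z \<longrightarrow> (1 + s n) * Im z \<le> Im (w z) \<and> F_transform M (w z) = (1 + of_real (s n)) * F_transform M z"
      and lim: "((\<lambda>y. w (\<i> * of_real y) / (\<i> * of_real y)) \<longlongrightarrow> 1 + of_real (s n)) at_top"
      by (elim exE conjE)
    have Im_w: "(1 + s n) * Im z \<le> Im (w z)" and F: "F_transform M (w z) = (1 + of_real (s n)) * F_transform M z"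
      if "0 < Im z" for z using w' that by simp_all
    define g where "g z = (w z - z) / s n" for z
    have "g holomorphic_on upper_half_plane"
      unfolding g_def using s(1)[of n] by (intro holomorphic_intros w) auto
    moreover have g: "0 < Im (g z)" if "0 < Im z" for z
    proof -
      have "0 < s n * Im z" using that s(1)[of n] by simp
      then have "0 < Im (w z) - Im z" using Im_w[OF that] by (simp add: algebra_simps)
      then show ?thesis using s(1)[of n] by (simp add: g_def)
    qed
    ultimately have "norm (g z) \<le> K * norm (g (\<i> * of_real R))" by (rule K)
    also have "\<dots> \<le> \<bar>K\<bar> * norm (g (\<i> * of_real R))" by (intro mult_right_mono) auto
    also have "norm (g (\<i> * of_real R)) \<le> 4 * R"
      using bound[OF s w F lim] s(1)[of n] by (simp add: g_def norm_divide field_simps)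
    finally have "norm (g z) \<le> \<bar>K\<bar> * (4 * R)" by (simp add: mult_left_mono)
    moreover have "F_transform M (z + s n * g z) = (1 + of_real (s n)) * F_transform M z"
      using F[OF z] s(1)[of n] by (simp add: g_def)
    ultimately show ?thesis using g[OF z] by blast
  qed
  then obtain g :: "nat \<Rightarrow> complex" where g: "\<And>n. 0 < Im (g n)" "\<And>n. norm (g n) \<le> \<bar>K\<bar> * (4 * R)"
    "\<And>n. F_transform M (z + s n * g n) = (1 + of_real (s n)) * F_transform M z" by metis
  have nz: "g n \<noteq> 0" "s n \<noteq> 0" for n using g(1)[of n] s(1)[of n] by auto
  have "(\<lambda>n. complex_of_real (s n) * g n) \<longlonglongrightarrow> 0"
  proof (rule tendsto_norm_zero_cancel, rule tendsto_sandwich[OF _ _ tendsto_const])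
    show "\<forall>\<^sub>F n in sequentially. norm (complex_of_real (s n) * g n) \<le> s n * (\<bar>K\<bar> * (4 * R))"
    proof (rule always_eventually, rule allI)
      fix n
      show "norm (complex_of_real (s n) * g n) \<le> s n * (\<bar>K\<bar> * (4 * R))"
        using mult_left_mono[OF g(2)[of n], of "s n"] s(1)[of n] by (simp add: norm_mult)
    qed
    show "(\<lambda>n. s n * (\<bar>K\<bar> * (4 * R))) \<longlonglongrightarrow> 0" using tendsto_mult_right[OF s0] by simp
  qed auto
  moreover have "((\<lambda>h. (F_transform M (z + h) - F_transform M z) / h) \<longlongrightarrow> deriv (F_transform M) z) (at 0)"
    using has_field_derivative_F_transform[OF z] by (simp add: DERIV_def)
  ultimately have "(\<lambda>n. (F_transform M (z + s n * g n) - F_transform M z) / (s n * g n))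
      \<longlonglongrightarrow> deriv (F_transform M) z"
    using nz by (auto simp: tendsto_at_iff_sequentially comp_def)
  moreover have "(F_transform M (z + s n * g n) - F_transform M z) / (s n * g n) = F_transform M z / g n" for n
    unfolding g(3) using nz[of n] by (simp add: field_simps)
  ultimately have "(\<lambda>n. F_transform M z / g n) \<longlonglongrightarrow> deriv (F_transform M) z" by simp
  then have "(\<lambda>n. F_transform M z / g n / F_transform M z) \<longlonglongrightarrow> deriv (F_transform M) z / F_transform M z"
    by (intro tendsto_divide tendsto_const F_transform_nonzero z)
  then have "(\<lambda>n. Im (1 / g n)) \<longlonglongrightarrow> Im (deriv (F_transform M) z / F_transform M z)"
    using F_transform_nonzero[OF z] by (intro tendsto_Im) simp
  then show ?thesis
  proof (rule LIMSEQ_le_const2)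
    show "\<exists>N. \<forall>n\<ge>N. Im (1 / g n) \<le> 0"
      using less_imp_le[OF g(1)] by (auto simp: Im_divide)
  qed
qed

end

section \<open>Logarithmic integrals\<close>

lemma norm_i_diff_real: "norm (\<i> - complex_of_real x) = sqrt (1 + x\<^sup>2)"
  by (simp add: cmod_def add.commute)

lemma norm_imaginary_diff_real:
  assumes "0 < y"
  shows "norm (\<i> * of_real y - complex_of_real x) = y * sqrt (1 + (x / y)\<^sup>2)"
proof -
  have "\<i> * of_real y - complex_of_real x = of_real y * (\<i> - complex_of_real (x / y))"
    using assms by (simp add: field_simps)
  then show ?thesis
    using assms by (simp only: norm_mult norm_i_diff_real norm_of_real abs_of_pos)
qed

lemma ln_sqrt_tendsto_0: "(\<lambda>n. ln (sqrt (1 + (x / real (Suc n))\<^sup>2))) \<longlonglongrightarrow> 0"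
proof -
  have "(\<lambda>n. x / real (Suc n)) \<longlonglongrightarrow> 0" by real_asymp
  then have "(\<lambda>n. ln (sqrt (1 + (x / real (Suc n))\<^sup>2))) \<longlonglongrightarrow> ln (sqrt (1 + 0\<^sup>2))"
    by (intro tendsto_intros) auto
  then show ?thesis by simp
qed

text \<open>The real part of \<open>Ln (\<i> - x)\<close> differs from
  \<open>ln (1 + \<bar>x\<bar>)\<close> by at most \<open>ln 2\<close>, so the logarithmic moment
  may be tested on the function that occurs naturally in the log potential.\<close>

lemma ln_norm_i_diff_bounds:
  "0 \<le> ln (norm (\<i> - complex_of_real x))"
  "ln (norm (\<i> - complex_of_real x)) \<le> ln (1 + \<bar>x\<bar>)"
  "ln (1 + \<bar>x\<bar>) \<le> ln (norm (\<i> - complex_of_real x)) + ln 2"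
proof -
  have 1: "1 \<le> norm (\<i> - complex_of_real x)" by (simp add: norm_i_diff_real)
  then show "0 \<le> ln (norm (\<i> - complex_of_real x))" by simp
  have "norm (\<i> - complex_of_real x) \<le> 1 + \<bar>x\<bar>"
    using norm_triangle_ineq4[of \<i> "complex_of_real x"] by simp
  moreover have pos: "0 < norm (\<i> - complex_of_real x)" "0 < 1 + \<bar>x\<bar>" using 1 by linarith+
  ultimately show "ln (norm (\<i> - complex_of_real x)) \<le> ln (1 + \<bar>x\<bar>)"
    by (simp only: ln_le_cancel_iff)
  have "\<bar>x\<bar> \<le> norm (\<i> - complex_of_real x)"
    using abs_Re_le_cmod[of "\<i> - complex_of_real x"] by simp
  then have "1 + \<bar>x\<bar> \<le> norm (\<i> - complex_of_real x) * 2" using 1 by simp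
  then have "ln (1 + \<bar>x\<bar>) \<le> ln (norm (\<i> - complex_of_real x) * 2)"
    using pos by (subst ln_le_cancel_iff) auto
  then show "ln (1 + \<bar>x\<bar>) \<le> ln (norm (\<i> - complex_of_real x)) + ln 2"
    using pos by (simp only: ln_mult_pos zero_less_numeral)
qed

lemma norm_Ln_le:
  assumes "0 < Im z"
  shows "norm (Ln z) \<le> \<bar>ln (norm z)\<bar> + pi"
proof -
  have "Re (Ln z) = ln (norm z)" using assms by (intro Re_Ln) auto
  then show ?thesis using cmod_le[of "Ln z"] Im_Ln_pos_lt_imp[OF assms] by linarith
qed

context real_distribution
begin

lemma integrable_ln_one_plus_abs:
  assumes "integrable M (\<lambda>x. ln (norm (\<i> - complex_of_real x)))"
  shows "integrable M (\<lambda>x. ln (1 + \<bar>x\<bar>))"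
proof (rule Bochner_Integration.integrable_bound)
  show "integrable M (\<lambda>x. ln (norm (\<i> - complex_of_real x)) + ln 2)" using assms by simp
  show "AE x in M. norm (ln (1 + \<bar>x\<bar>)) \<le> norm (ln (norm (\<i> - complex_of_real x)) + ln 2)"
    using ln_norm_i_diff_bounds(1,3) by (intro AE_I2) (simp add: abs_of_nonneg)
qed simp

lemma integrable_Ln_diff_real:
  assumes int: "integrable M (\<lambda>x. ln (1 + \<bar>x\<bar>))" and z: "0 < Im z"
  shows "integrable M (\<lambda>x. Ln (z - complex_of_real x))"
proof -
  have "integrable M (\<lambda>x. Ln (\<i> - complex_of_real x))"
  proof (rule Bochner_Integration.integrable_bound)
    show "integrable M (\<lambda>x. ln (1 + \<bar>x\<bar>) + pi)" using int by simp
    show "(\<lambda>x. Ln (\<i> - complex_of_real x)) \<in> borel_measurable M" by (rule measurable_Ln_diff) simp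
    show "AE x in M. norm (Ln (\<i> - complex_of_real x)) \<le> norm (ln (1 + \<bar>x\<bar>) + pi)"
    proof (rule AE_I2)
      fix x
      show "norm (Ln (\<i> - complex_of_real x)) \<le> norm (ln (1 + \<bar>x\<bar>) + pi)"
        using norm_Ln_le[of "\<i> - complex_of_real x"] ln_norm_i_diff_bounds(1,2)[of x] by simp
    qed
  qed
  from Bochner_Integration.integrable_add[OF integrable_Ln_diff[OF z] this] show ?thesis by simp
qed

lemma log_integral_eq_log_potential:
  assumes "integrable M (\<lambda>x. ln (1 + \<bar>x\<bar>))" "0 < Im z"
  shows "(LINT x|M. Ln (z - complex_of_real x)) = log_potential M z + (LINT x|M. Ln (\<i> - complex_of_real x))"
  unfolding log_potential_def
  using integrable_Ln_diff_real[OF assms] integrable_Ln_diff_real[OF assms(1), of \<i>] by simp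

lemma has_field_derivative_log_integral:
  assumes int: "integrable M (\<lambda>x. ln (1 + \<bar>x\<bar>))" and z: "0 < Im z"
  shows "((\<lambda>z. LINT x|M. Ln (z - complex_of_real x)) has_field_derivative cauchy_transform M z) (at z)"
proof (rule has_field_derivative_transform_within_open[OF _ open_upper_half_plane])
  show "((\<lambda>z. log_potential M z + (LINT x|M. Ln (\<i> - complex_of_real x)))
      has_field_derivative cauchy_transform M z) (at z)"
    using has_field_derivative_log_potential[OF z] by (auto intro!: derivative_eq_intros)
  show "log_potential M w + (LINT x|M. Ln (\<i> - complex_of_real x)) = (LINT x|M. Ln (w - complex_of_real x))"
    if "w \<in> upper_half_plane" for w
    using log_integral_eq_log_potential[OF int, of w] that by simp
qed (use z in simp)

lemma Im_log_integral_bounds: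
  assumes int: "integrable M (\<lambda>x. ln (1 + \<bar>x\<bar>))" and z: "0 < Im z"
  shows "0 \<le> Im (LINT x|M. Ln (z - complex_of_real x))" "Im (LINT x|M. Ln (z - complex_of_real x)) \<le> pi"
proof -
  note i = integrable_Ln_diff_real[OF int z]
  have b: "0 \<le> Im (Ln (z - complex_of_real x))" "Im (Ln (z - complex_of_real x)) \<le> pi" for x
    using Im_Ln_pos_lt_imp[of "z - complex_of_real x"] z by auto
  have eq: "Im (LINT x|M. Ln (z - complex_of_real x)) = (LINT x|M. Im (Ln (z - complex_of_real x)))"
    using i by simp
  show "0 \<le> Im (LINT x|M. Ln (z - complex_of_real x))" unfolding eq using b by simp
  have "(LINT x|M. Im (Ln (z - complex_of_real x))) \<le> (LINT x|M. pi)"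
    using i b by (intro integral_mono) auto
  then show "Im (LINT x|M. Ln (z - complex_of_real x)) \<le> pi"
    unfolding eq by (simp add: prob_space[simplified])
qed

text \<open>This fixes the multiplicative constant in (d). Subtracting \<open>Ln (\<i> * y)\<close>
  under the integral leaves real part \<open>ln (sqrt (1 + (x / y)\<^sup>2))\<close> and imaginary
  part \<open>arctan (x / y)\<close>. Both tend to 0, and since \<open>y = Suc n\<close> is at least
  1, the logarithmic moment dominates them.\<close>

lemma exp_log_integral_imaginary_axis:
  assumes int: "integrable M (\<lambda>x. ln (1 + \<bar>x\<bar>))"
  shows "(\<lambda>n. exp (LINT x|M. Ln (\<i> * of_real (real (Suc n)) - complex_of_real x)) / (\<i> * of_real (real (Suc n))))
    \<longlonglongrightarrow> 1"
proof -
  define Y where "Y n = \<i> * of_real (real (Suc n))" for n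
  have Y: "0 < Im (Y n)" "Y n \<noteq> 0" for n by (simp_all add: Y_def complex_eq_iff del: of_nat_Suc)
  define u where "u n x = Ln (Y n - complex_of_real x) - Ln (Y n)" for n x
  have u: "u n x = Complex (ln (sqrt (1 + (x / real (Suc n))\<^sup>2))) (arctan (x / real (Suc n)))" for n x
  proof -
    have "norm (Y n - of_real x) = real (Suc n) * sqrt (1 + (x / real (Suc n))\<^sup>2)"
      unfolding Y_def by (rule norm_imaginary_diff_real) simp
    moreover have "norm (Y n) = real (Suc n)" by (simp add: Y_def norm_mult del: of_nat_Suc)
    moreover have "0 < sqrt (1 + (x / real (Suc n))\<^sup>2)" by (simp add: add_pos_nonneg)
    ultimately have "Re (u n x) = ln (sqrt (1 + (x / real (Suc n))\<^sup>2))"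
      using Y(2)[of n] diff_real_nonzero[OF Y(1), of n x]
      by (simp add: u_def ln_mult_pos del: of_nat_Suc real_sqrt_gt_0_iff)
    moreover have "Im (u n x) = arctan (x / real (Suc n))"
      using Im_Ln_upper_half_plane[of "Y n"] Im_Ln_upper_half_plane[of "Y n - of_real x"] Y(1)[of n]
      by (simp add: u_def Y_def arctan_minus del: of_nat_Suc)
    ultimately show ?thesis by (simp add: complex_eq_iff)
  qed
  have i: "integrable M (\<lambda>x. Ln (Y n - complex_of_real x))" for n
    by (rule integrable_Ln_diff_real[OF int Y(1)])
  have "(\<lambda>n. LINT x|M. u n x) \<longlonglongrightarrow> (LINT x|M. 0)"
  proof (rule integral_dominated_convergence)
    show "u n \<in> borel_measurable M" for n
      unfolding u_def using measurable_Ln_diff[OF Y(1)] by measurable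
    show "integrable M (\<lambda>x. ln (1 + \<bar>x\<bar>) + pi)" using int by simp
    show "AE x in M. (\<lambda>n. u n x) \<longlonglongrightarrow> 0"
    proof (rule AE_I2)
      fix x :: real
      have "(\<lambda>n. Complex (ln (sqrt (1 + (x / real (Suc n))\<^sup>2))) (arctan (x / real (Suc n)))) \<longlonglongrightarrow> Complex 0 0"
      proof (rule tendsto_Complex)
        show "(\<lambda>n. ln (sqrt (1 + (x / real (Suc n))\<^sup>2))) \<longlonglongrightarrow> 0" by (rule ln_sqrt_tendsto_0)
        show "(\<lambda>n. arctan (x / real (Suc n))) \<longlonglongrightarrow> 0"
        proof -
          have "(\<lambda>n. x / real (Suc n)) \<longlonglongrightarrow> 0" by real_asymp
          then show ?thesis using tendsto_arctan by fastforce
        qed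
      qed
      then show "(\<lambda>n. u n x) \<longlonglongrightarrow> 0" by (simp add: u zero_complex.code)
    qed
    show "AE x in M. norm (u n x) \<le> ln (1 + \<bar>x\<bar>) + pi" for n
    proof (rule AE_I2)
      fix x :: real
      have "\<bar>x / real (Suc n)\<bar> \<le> \<bar>x\<bar>" by (simp add: divide_le_eq mult_le_cancel_left1)
      then have "(x / real (Suc n))\<^sup>2 \<le> x\<^sup>2" by (rule abs_le_square_iff[THEN iffD1])
      then have "sqrt (1 + (x / real (Suc n))\<^sup>2) \<le> sqrt (1 + x\<^sup>2)" by simp
      then have "ln (sqrt (1 + (x / real (Suc n))\<^sup>2)) \<le> ln (sqrt (1 + x\<^sup>2))"
        by (subst ln_le_cancel_iff) (auto simp: add_pos_nonneg)
      also have "\<dots> \<le> ln (1 + \<bar>x\<bar>)" using ln_norm_i_diff_bounds(2)[of x] by (simp add: norm_i_diff_real)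
      finally have "ln (sqrt (1 + (x / real (Suc n))\<^sup>2)) \<le> ln (1 + \<bar>x\<bar>)" .
      moreover have "0 \<le> ln (sqrt (1 + (x / real (Suc n))\<^sup>2))" by simp
      moreover have "\<bar>arctan (x / real (Suc n))\<bar> \<le> pi"
        using arctan_lbound[of "x / real (Suc n)"] arctan_ubound[of "x / real (Suc n)"] by linarith
      ultimately show "norm (u n x) \<le> ln (1 + \<bar>x\<bar>) + pi"
        using cmod_le[of "u n x"] by (simp add: u)
    qed
  qed simp
  then have "(\<lambda>n. exp (LINT x|M. u n x)) \<longlonglongrightarrow> exp 0" by (intro tendsto_exp) simp
  moreover have "exp (LINT x|M. u n x) = exp (LINT x|M. Ln (Y n - complex_of_real x)) / Y n" for n
    unfolding u_def using i[of n] Y(2)[of n] by (simp add: prob_space[simplified] exp_diff)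
  ultimately show ?thesis by (simp add: Y_def)
qed

section \<open>From the sign of the logarithmic derivative to the logarithmic integral\<close>

lemma log_deriv_F_transform_representation:
  assumes c: "\<And>z. 0 < Im z \<Longrightarrow> Im (deriv (F_transform M) z / F_transform M z) \<le> 0"
  shows "\<exists>\<nu>. real_distribution \<nu> \<and>
    (\<forall>z. 0 < Im z \<longrightarrow> cauchy_transform \<nu> z = deriv (F_transform M) z / F_transform M z)"
proof (rule cauchy_transform_representation[OF _ c])
  show "(\<lambda>z. deriv (F_transform M) z / F_transform M z) holomorphic_on upper_half_plane"
    using F_transform_nonzero
    by (intro holomorphic_intros holomorphic_F_transform holomorphic_deriv open_upper_half_plane) auto
  have axis: "filterlim (\<lambda>y. \<i> * of_real y) (nontangential 1) at_top"
    by (rule filterlim_nontangential_imaginary_axis) simp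
  show "((\<lambda>y. \<i> * of_real y * (deriv (F_transform M) (\<i> * of_real y) / F_transform M (\<i> * of_real y))) \<longlongrightarrow> 1) at_top"
    using tendsto_divide[OF filterlim_compose[OF deriv_F_transform_nontangential axis]
        F_transform_imaginary_axis[OF real_distribution_axioms]]
    by (simp add: mult.commute)
qed

lemma F_transform_eq_exp_log_potential:
  assumes \<nu>: "real_distribution \<nu>"
    and G: "\<And>z. 0 < Im z \<Longrightarrow> cauchy_transform \<nu> z = deriv (F_transform M) z / F_transform M z"
    and z: "0 < Im z"
  shows "F_transform M z = F_transform M \<i> * exp (log_potential \<nu> z)"
proof -
  interpret \<nu>: real_distribution \<nu> by fact
  have "\<exists>c. \<forall>z\<in>upper_half_plane. F_transform M z * exp (- log_potential \<nu> z) = c"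
  proof (rule has_field_derivative_zero_constant[OF convex_upper_half_plane])
    fix z assume "z \<in> upper_half_plane"
    then have z: "0 < Im z" by simp
    have "((\<lambda>z. F_transform M z * exp (- log_potential \<nu> z)) has_field_derivative 0) (at z)"
      by (auto intro!: derivative_eq_intros has_field_derivative_F_transform[OF z]
          \<nu>.has_field_derivative_log_potential[OF z] simp: G[OF z] F_transform_nonzero[OF z])
    then show "((\<lambda>z. F_transform M z * exp (- log_potential \<nu> z)) has_field_derivative 0)
        (at z within upper_half_plane)"
      by (rule has_field_derivative_at_within)
  qed
  then obtain c where c: "F_transform M z * exp (- log_potential \<nu> z) = c" if "0 < Im z" for z
    by auto
  from c[OF z] c[of \<i>] show ?thesis by (simp add: exp_minus field_simps)
qed

lemma Im_log_deriv_imp_exp_log_integral: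
  assumes c: "\<And>z. 0 < Im z \<Longrightarrow> Im (deriv (F_transform M) z / F_transform M z) \<le> 0"
  shows "\<exists>\<nu>. real_distribution \<nu> \<and> integrable \<nu> (\<lambda>x. ln (1 + \<bar>x\<bar>)) \<and>
    (\<forall>z. 0 < Im z \<longrightarrow> F_transform M z = exp (LINT x|\<nu>. Ln (z - complex_of_real x)))"
proof -
  from log_deriv_F_transform_representation[OF c] obtain \<nu> where \<nu>: "real_distribution \<nu>" and
    G: "\<And>z. 0 < Im z \<Longrightarrow> cauchy_transform \<nu> z = deriv (F_transform M) z / F_transform M z"
    by blast
  interpret \<nu>: real_distribution \<nu> by fact
  have F: "F_transform M z = F_transform M \<i> * exp (log_potential \<nu> z)" if "0 < Im z" for z
    by (rule F_transform_eq_exp_log_potential[OF \<nu> _ that]) (rule G)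
  have Fi: "F_transform M \<i> \<noteq> 0" by (rule F_transform_nonzero) simp
  define Y where "Y n = \<i> * of_real (real (Suc n))" for n
  have Y: "0 < Im (Y n)" "Y n \<noteq> 0" "norm (Y n) = real (Suc n)" for n
    by (simp_all add: Y_def complex_eq_iff norm_mult del: of_nat_Suc)
  have limY: "(\<lambda>n. F_transform M (Y n) / Y n) \<longlonglongrightarrow> 1"
    unfolding Y_def
    by (rule filterlim_compose[OF F_transform_imaginary_axis[OF real_distribution_axioms]
          filterlim_compose[OF filterlim_real_sequentially filterlim_Suc]])
  \<comment> \<open>Taking moduli in \<open>F = F \<i> * exp (log_potential \<nu>)\<close> at
    \<open>Y n\<close> gives the integral of \<open>u n\<close> as
    \<open>ln (norm (F \<i>)) - ln (norm (F (Y n) / Y n))\<close>, which converges. Since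
    \<open>Y 0 = \<i>\<close>, \<open>u 0\<close> vanishes, and \<open>u n\<close> increases to
    \<open>ln (norm (\<i> - x))\<close>: monotone convergence applies and delivers the
    moment.\<close>
  define u where "u n x = ln (norm (\<i> - complex_of_real x)) - ln (sqrt (1 + (x / real (Suc n))\<^sup>2))" for n x
  have u: "u n x = ln (real (Suc n)) - Re (Ln (Y n - complex_of_real x) - Ln (\<i> - complex_of_real x))" for n x
  proof -
    have "norm (Y n - of_real x) = real (Suc n) * sqrt (1 + (x / real (Suc n))\<^sup>2)"
      unfolding Y_def by (rule norm_imaginary_diff_real) simp
    moreover have "0 < sqrt (1 + (x / real (Suc n))\<^sup>2)" by (simp add: add_pos_nonneg)
    ultimately show ?thesis
      using diff_real_nonzero[OF Y(1), of n x] diff_real_nonzero[of \<i> x]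
      by (simp add: u_def ln_mult_pos del: of_nat_Suc real_sqrt_gt_0_iff)
  qed
  have Phi_i: "integrable \<nu> (\<lambda>x. Ln (Y n - complex_of_real x) - Ln (\<i> - complex_of_real x))" for n
    by (rule \<nu>.integrable_Ln_diff[OF Y(1)])
  have ui: "integrable \<nu> (u n)" for n
    unfolding u by (intro Bochner_Integration.integrable_diff integrable_Re Phi_i) simp
  have uint: "(LINT x|\<nu>. u n x) = ln (norm (F_transform M \<i>)) - ln (norm (F_transform M (Y n) / Y n))" for n
  proof -
    have "(LINT x|\<nu>. u n x) = ln (real (Suc n)) - Re (log_potential \<nu> (Y n))"
      unfolding u log_potential_def using Phi_i[of n]
      by (simp add: \<nu>.prob_space[simplified] del: of_nat_Suc minus_complex.sel)
    moreover have "ln (norm (F_transform M (Y n))) = ln (norm (F_transform M \<i>)) + Re (log_potential \<nu> (Y n))"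
      unfolding F[OF Y(1)] using Fi by (simp add: norm_mult ln_mult)
    moreover have "ln (norm (F_transform M (Y n) / Y n)) = ln (norm (F_transform M (Y n))) - ln (real (Suc n))"
      unfolding norm_divide Y(3) using F_transform_nonzero[OF Y(1)] by (simp add: ln_div del: of_nat_Suc)
    ultimately show ?thesis by simp
  qed
  have ulim: "(\<lambda>n. LINT x|\<nu>. u n x) \<longlonglongrightarrow> ln (norm (F_transform M \<i>))"
  proof -
    have "(\<lambda>n. ln (norm (F_transform M \<i>)) - ln (norm (F_transform M (Y n) / Y n)))
        \<longlonglongrightarrow> ln (norm (F_transform M \<i>)) - ln (norm (1::complex))"
      by (intro tendsto_intros limY) simp
    then show ?thesis by (simp add: uint)
  qed
  have umono: "mono (\<lambda>n. u n x)" for x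
  proof (rule monoI)
    fix m n :: nat assume "m \<le> n"
    then have "\<bar>x / real (Suc n)\<bar> \<le> \<bar>x / real (Suc m)\<bar>" by (simp add: frac_le)
    then have "(x / real (Suc n))\<^sup>2 \<le> (x / real (Suc m))\<^sup>2" by (rule abs_le_square_iff[THEN iffD1])
    then have "sqrt (1 + (x / real (Suc n))\<^sup>2) \<le> sqrt (1 + (x / real (Suc m))\<^sup>2)" by simp
    then show "u m x \<le> u n x"
      unfolding u_def by (intro diff_left_mono, subst ln_le_cancel_iff) (auto simp: add_pos_nonneg)
  qed
  have upos: "0 \<le> u n x" for n x
  proof -
    have "u 0 x = 0" by (simp add: u_def norm_i_diff_real)
    then show ?thesis using monoD[OF umono, of 0 n x] by simp
  qed
  have upt: "(\<lambda>n. u n x) \<longlonglongrightarrow> ln (norm (\<i> - complex_of_real x))" for x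
  proof -
    have "(\<lambda>n. a - ln (sqrt (1 + (x / real (Suc n))\<^sup>2))) \<longlonglongrightarrow> a" for a :: real
      using tendsto_diff[OF tendsto_const ln_sqrt_tendsto_0] by simp
    then show ?thesis by (simp add: u_def)
  qed
  have "integrable \<nu> (\<lambda>x. ln (norm (\<i> - complex_of_real x)))"
    by (rule integral_monotone_convergence_nonneg(1)[OF ui _ _ _ ulim]) (use umono upos upt in auto)
  then have int: "integrable \<nu> (\<lambda>x. ln (1 + \<bar>x\<bar>))" by (rule \<nu>.integrable_ln_one_plus_abs)
  \<comment> \<open>Only now may the normalisation at \<open>\<i>\<close> be separated from the log
    potential. What remains is a complex constant; it is 1 because \<open>F\<close> and the
    exponential have the same asymptotics on the imaginary axis.\<close>
  define k where "k = F_transform M \<i> * exp (- (LINT x|\<nu>. Ln (\<i> - complex_of_real x)))"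
  have Fk: "F_transform M z = k * exp (LINT x|\<nu>. Ln (z - complex_of_real x))" if "0 < Im z" for z
    unfolding \<nu>.log_integral_eq_log_potential[OF int that] F[OF that] k_def
    by (simp add: exp_add exp_minus)
  have "(\<lambda>n. k * (exp (LINT x|\<nu>. Ln (Y n - complex_of_real x)) / Y n)) \<longlonglongrightarrow> k * 1"
    unfolding Y_def by (intro tendsto_mult_left \<nu>.exp_log_integral_imaginary_axis[OF int])
  moreover have "k * (exp (LINT x|\<nu>. Ln (Y n - complex_of_real x)) / Y n) = F_transform M (Y n) / Y n" for n
    by (simp add: Fk[OF Y(1)])
  ultimately have "(\<lambda>n. F_transform M (Y n) / Y n) \<longlonglongrightarrow> k" by (simp only: mult_1_right)
  then have "k = 1" using limY by (rule LIMSEQ_unique)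
  then show ?thesis using \<nu> int Fk by auto
qed

end

text \<open>The logarithm of \<open>F\<close> is univalent by the Noshiro--Warschawski criterion and has imaginary
  part in \<open>[0, pi]\<close>, where the exponential is injective.  Starlikeness of \<open>F\<close> means that the image of
  the logarithm is invariant under positive translations; along such a translation the preimage moves
  upwards, so it can only escape to infinity, where \<open>F\<close> is unbounded.\<close>

locale exp_log_integral = \<mu>: real_distribution \<mu> + \<nu>: real_distribution \<nu>
  for \<mu> \<nu> :: "real measure" +
  assumes integrable_ln: "integrable \<nu> (\<lambda>x. ln (1 + \<bar>x\<bar>))"
    and F_eq_exp: "0 < Im z \<Longrightarrow> F_transform \<mu> z = exp (LINT x|\<nu>. Ln (z - complex_of_real x))"
begin

definition L :: "complex \<Rightarrow> complex" where
  "L z = (LINT x|\<nu>. Ln (z - complex_of_real x))"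

lemma F_eq: "0 < Im z \<Longrightarrow> F_transform \<mu> z = exp (L z)"
  unfolding L_def by (rule F_eq_exp)

lemma DERIV_L: "0 < Im z \<Longrightarrow> (L has_field_derivative cauchy_transform \<nu> z) (at z)"
  unfolding L_def[abs_def] by (rule \<nu>.has_field_derivative_log_integral[OF integrable_ln])

lemma holomorphic_L: "L holomorphic_on upper_half_plane"
  by (rule holomorphic_onI, rule field_differentiable_at_within)
     (auto simp only: field_differentiable_def upper_half_plane_iff intro: DERIV_L)

lemma log_deriv_F:
  assumes z: "0 < Im z"
  shows "deriv (F_transform \<mu>) z / F_transform \<mu> z = cauchy_transform \<nu> z"
proof -
  have "(F_transform \<mu> has_field_derivative exp (L z) * cauchy_transform \<nu> z) (at z)"
  proof (rule has_field_derivative_transform_within_open[OF _ open_upper_half_plane])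
    show "((\<lambda>z. exp (L z)) has_field_derivative exp (L z) * cauchy_transform \<nu> z) (at z)"
      by (auto intro!: derivative_eq_intros DERIV_L[OF z])
  qed (use z F_eq in auto)
  then show ?thesis using F_eq[OF z] by (simp add: DERIV_imp_deriv)
qed

lemma inj_on_L: "inj_on L upper_half_plane"
proof (rule inj_onI, rule ccontr)
  fix z w assume "z \<in> upper_half_plane" "w \<in> upper_half_plane" and eq: "L z = L w" and ne: "z \<noteq> w"
  then have zw: "0 < Im z" "0 < Im w" by auto
  define p where "p t = w + of_real t * (z - w)" for t
  have p: "0 < Im (p t)" if "0 \<le> t" "t \<le> 1" for t
  proof -
    have "p t = (1 - t) *\<^sub>R w + t *\<^sub>R z" by (simp add: p_def scaleR_conv_of_real algebra_simps)
    then show ?thesis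
      using convexD[OF convex_upper_half_plane, of w z "1 - t" t] zw that by simp
  qed
  \<comment> \<open>Dividing by \<open>z - w\<close> makes the derivative along the segment equal to
    the Cauchy transform itself. Its imaginary part is negative, so the endpoint values cannot
    coincide.\<close>
  have "((\<lambda>t. Im (L (p t) / (z - w))) has_field_derivative Im (cauchy_transform \<nu> (p t))) (at t)"
    if "0 \<le> t" "t \<le> 1" for t
  proof -
    have "((\<lambda>s. w + s * (z - w)) has_field_derivative z - w) (at (of_real t))"
      by (auto intro!: derivative_eq_intros)
    from DERIV_chain2[OF DERIV_L[OF p[OF that], unfolded p_def] this]
    have "((\<lambda>s. L (w + s * (z - w)) / (z - w)) has_field_derivative cauchy_transform \<nu> (p t)) (at (of_real t))"
      using ne by (auto intro!: derivative_eq_intros simp: p_def)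
    then show ?thesis
      unfolding p_def by (intro has_field_derivative_Im has_vector_derivative_real_field)
  qed
  then have "Im (L (p 1) / (z - w)) < Im (L (p 0) / (z - w))"
    using \<nu>.Im_cauchy_transform_neg p by (intro DERIV_neg_imp_decreasing[of 0 1]) auto
  then show False using eq by (simp add: p_def)
qed

lemma univalent_F: "univalent_on (F_transform \<mu>) upper_half_plane"
  unfolding univalent_on_def
proof (intro conjI \<mu>.holomorphic_F_transform inj_onI)
  fix z w assume z: "z \<in> upper_half_plane" and w: "w \<in> upper_half_plane"
    and eq: "F_transform \<mu> z = F_transform \<mu> w"
  have "\<bar>Im (L z) - Im (L w)\<bar> < 2 * pi"
    using \<nu>.Im_log_integral_bounds[OF integrable_ln, of z] \<nu>.Im_log_integral_bounds[OF integrable_ln, of w]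
      z w pi_gt_zero unfolding L_def upper_half_plane_iff by linarith
  moreover have "exp (L z) = exp (L w)" using eq z w F_eq by auto
  ultimately have "L z = L w" by (rule exp_complex_eqI)
  then show "z = w" using inj_on_L z w by (simp add: inj_on_eq_iff)
qed

lemma L_translation:
  assumes z0: "0 < Im z0" and t: "0 \<le> t"
  shows "L z0 + of_real t \<in> L ` upper_half_plane"
proof (rule ccontr)
  assume neg: "L z0 + of_real t \<notin> L ` upper_half_plane"
  obtain g where g: "g holomorphic_on L ` upper_half_plane"
    "\<And>z. z \<in> upper_half_plane \<Longrightarrow> deriv L z * deriv g (L z) = 1"
    "\<And>z. z \<in> upper_half_plane \<Longrightarrow> g (L z) = z"
    using holomorphic_has_inverse[OF holomorphic_L open_upper_half_plane inj_on_L] by blast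
  have open_L: "open (L ` upper_half_plane)"
    by (rule open_mapping_thm3[OF holomorphic_L open_upper_half_plane inj_on_L])
  \<comment> \<open>The parameters at which the translated point has left the image. This set is
    closed because the image is open, so there is a first such parameter
    \<open>\<tau>\<close>.\<close>
  define A where "A = {0..t} \<inter> (\<lambda>r. L z0 + complex_of_real r) -` (- (L ` upper_half_plane))"
  have "closed A"
    unfolding A_def using open_L
    by (intro continuous_closed_preimage continuous_intros) (auto simp: closed_def)
  moreover have "t \<in> A" using neg t by (simp add: A_def)
  moreover have bdd: "bdd_below A" by (auto simp: A_def intro: bdd_belowI[of _ 0])
  ultimately have \<tau>A: "Inf A \<in> A" using closed_contains_Inf[of A] by blast
  define \<tau> where "\<tau> = Inf A"
  have \<tau>: "0 \<le> \<tau>" "\<tau> \<le> t" "L z0 + of_real \<tau> \<notin> L ` upper_half_plane"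
    using \<tau>A by (auto simp: A_def \<tau>_def)
  then have "\<tau> \<noteq> 0" using z0 by (auto simp: image_iff)
  then have "0 < \<tau>" using \<tau> by simp
  have before: "L z0 + of_real r \<in> L ` upper_half_plane" if "0 \<le> r" "r < \<tau>" for r
  proof (rule ccontr)
    assume "L z0 + of_real r \<notin> L ` upper_half_plane"
    then have "r \<in> A" using that \<tau> by (simp add: A_def)
    then show False using cInf_lower[OF _ bdd] that by (fastforce simp: \<tau>_def)
  qed
  define p where "p r = g (L z0 + of_real r)" for r
  have p: "0 < Im (p r)" "L (p r) = L z0 + of_real r" if r: "0 \<le> r" "r < \<tau>" for r
  proof -
    from before[OF r] obtain z where "z \<in> upper_half_plane" "L z0 + of_real r = L z" by auto
    then show "0 < Im (p r)" "L (p r) = L z0 + of_real r" using g(3)[of z] by (auto simp: p_def)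
  qed
  \<comment> \<open>The curve of preimages has velocity \<open>1 / cauchy_transform \<nu>\<close>,
    which lies in the upper half-plane; this keeps the curve above height
    \<open>Im z0\<close>.\<close>
  have Dp: "((\<lambda>r. Im (p r)) has_field_derivative Im (1 / cauchy_transform \<nu> (p r))) (at r)"
    if r: "0 \<le> r" "r < \<tau>" for r
  proof -
    have "(g has_field_derivative deriv g (L z0 + of_real r)) (at (L z0 + of_real r))"
      using g(1) open_L before[OF r] by (rule holomorphic_derivI)
    moreover have "((\<lambda>s. L z0 + s) has_field_derivative 1) (at (of_real r))"
      by (auto intro!: derivative_eq_intros)
    ultimately have "((\<lambda>s. g (L z0 + s)) has_field_derivative deriv g (L z0 + of_real r) * 1) (at (of_real r))"
      by (rule DERIV_chain2)
    moreover have "deriv g (L z0 + of_real r) * 1 = 1 / cauchy_transform \<nu> (p r)"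
    proof -
      have "deriv L (p r) * deriv g (L (p r)) = 1" using g(2)[of "p r"] p(1)[OF r] by simp
      then have "cauchy_transform \<nu> (p r) * deriv g (L z0 + of_real r) = 1"
        by (simp only: DERIV_imp_deriv[OF DERIV_L[OF p(1)[OF r]]] p(2)[OF r])
      then show ?thesis using \<nu>.cauchy_transform_nonzero[OF p(1)[OF r]] by (simp add: eq_divide_eq mult.commute)
    qed
    ultimately show ?thesis
      unfolding p_def by (intro has_field_derivative_Im has_vector_derivative_real_field) (simp only:)
  qed
  have p0: "p 0 = z0" using g(3)[of z0] z0 by (simp add: p_def)
  have Im_p: "Im z0 \<le> Im (p r)" if r: "0 \<le> r" "r < \<tau>" for r
  proof -
    have "Im (p 0) \<le> Im (p r)"
    proof (rule DERIV_nonneg_imp_nondecreasing[OF r(1)])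
      fix s assume s: "0 \<le> s" "s \<le> r"
      then have s': "0 \<le> s" "s < \<tau>" using r by auto
      have "0 \<le> Im (1 / cauchy_transform \<nu> (p s))"
        using \<nu>.Im_cauchy_transform_neg[OF p(1)[OF s']] by (simp add: Im_divide divide_nonpos_nonneg)
      then show "\<exists>y. ((\<lambda>r. Im (p r)) has_real_derivative y) (at s) \<and> 0 \<le> y"
        using Dp[OF s'] by blast
    qed
    then show ?thesis by (simp add: p0)
  qed
  define r where "r n = \<tau> * (1 - 1 / real (Suc n))" for n
  have r: "0 \<le> r n" "r n < \<tau>" for n using \<open>0 < \<tau>\<close> by (auto simp: r_def)
  have rlim: "r \<longlonglongrightarrow> \<tau>" unfolding r_def by real_asymp
  \<comment> \<open>Along the curve \<open>norm F\<close> is \<open>exp (Re (L z0) + r)\<close>, so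
    the curve stays in a sublevel set of \<open>F\<close> above height \<open>Im z0\<close>. A limit
    point is then interior to the half-plane, and continuity of \<open>L\<close> there contradicts
    the choice of \<open>\<tau>\<close>.\<close>
  have "bounded (range (\<lambda>n. p (r n)))"
  proof (rule bounded_subset[OF \<mu>.bounded_F_transform_sublevel[OF z0]])
    have "norm (F_transform \<mu> (p (r n))) \<le> exp (Re (L z0) + \<tau>)" for n
      using F_eq[OF p(1)[OF r]] p(2)[OF r] r(2)[of n] by simp
    then show "range (\<lambda>n. p (r n)) \<subseteq> {z. Im z0 \<le> Im z \<and> norm (F_transform \<mu> z) \<le> exp (Re (L z0) + \<tau>)}"
      using Im_p[OF r] by auto
  qed
  then obtain l \<sigma> where \<sigma>: "strict_mono \<sigma>" and l: "((\<lambda>n. p (r n)) \<circ> \<sigma>) \<longlonglongrightarrow> l"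
    using bounded_imp_convergent_subsequence by blast
  have "Im z0 \<le> Im l"
    by (rule LIMSEQ_le_const[OF tendsto_Im[OF l]]) (use Im_p[OF r] in auto)
  then have l0: "0 < Im l" using z0 by simp
  have "(\<lambda>n. L (p (r (\<sigma> n)))) \<longlonglongrightarrow> L l"
    using isCont_tendsto_compose[OF DERIV_isCont[OF DERIV_L[OF l0]] l] by (simp add: comp_def)
  moreover have "(\<lambda>n. L (p (r (\<sigma> n)))) \<longlonglongrightarrow> L z0 + of_real \<tau>"
    unfolding p(2)[OF r] by (intro tendsto_intros LIMSEQ_subseq_LIMSEQ[OF rlim \<sigma>, unfolded comp_def])
  ultimately have "L z0 + of_real \<tau> = L l" by (rule LIMSEQ_unique[rotated])
  then show False using \<tau>(3) l0 by auto
qed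

lemma starlike_F: "starlike_wrt_infinity (F_transform \<mu> ` upper_half_plane)"
  unfolding starlike_wrt_infinity_def
proof (intro allI impI subsetI)
  fix c :: real and v
  assume c: "1 < c" and "v \<in> (\<lambda>w. complex_of_real c * w) ` F_transform \<mu> ` upper_half_plane"
  then obtain z0 where z0: "0 < Im z0" and v: "v = c * F_transform \<mu> z0" by auto
  from L_translation[OF z0, of "ln c"] c obtain z where z: "0 < Im z" "L z0 + of_real (ln c) = L z"
    by auto
  have "v = exp (L z0 + of_real (ln c))" using c z0 by (simp add: v F_eq exp_add exp_of_real)
  then have "v = F_transform \<mu> z" using z F_eq by simp
  then show "v \<in> F_transform \<mu> ` upper_half_plane" using z(1) by auto
qed

end

section \<open>From starlikeness to selfdecomposability\<close>

context real_distribution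
begin

text \<open>Brouwer's theorem for the map \<open>z \<mapsto> p + (z - F z)\<close> on the ball of
  radius \<open>\<epsilon> * Y\<close> about \<open>\<i> * Y\<close>. There \<open>norm z\<close> is
  at most \<open>5 / 4 * Y\<close>, so the map moves off the centre by at most
  \<open>\<epsilon> / 4 * Y + 5 / 16 * \<epsilon> * Y\<close>, which is less than the radius. The
  location of the preimage controls the asymptotics of the inverse of \<open>F\<close>.\<close>

lemma F_transform_surjective_near:
  assumes \<epsilon>: "0 < \<epsilon>" "\<epsilon> \<le> 1 / 4"
  shows "\<exists>R>0. \<forall>Y\<ge>R. \<forall>p. norm (p - \<i> * of_real Y) \<le> \<epsilon> / 4 * Y \<longrightarrow>
    (\<exists>v. 0 < Im v \<and> norm (v - \<i> * of_real Y) \<le> \<epsilon> * Y \<and> F_transform M v = p)"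
proof -
  have "\<forall>\<^sub>F z in nontangential 2. dist (F_transform M z / z) 1 < \<epsilon> / 4"
    using F_transform_nontangential by (rule tendstoD) (use \<epsilon> in simp)
  then obtain R where R: "0 < R"
    and dist: "\<And>z. R \<le> Im z \<Longrightarrow> norm z \<le> 2 * Im z \<Longrightarrow> dist (F_transform M z / z) 1 < \<epsilon> / 4"
    unfolding eventually_nontangential by blast
  have "\<exists>v. 0 < Im v \<and> norm (v - \<i> * of_real Y) \<le> \<epsilon> * Y \<and> F_transform M v = p"
    if Y: "2 * R \<le> Y" and p: "norm (p - \<i> * of_real Y) \<le> \<epsilon> / 4 * Y" for Y p
  proof -
    have Y0: "0 < Y" using Y R by simp
    have \<epsilon>Y: "0 < \<epsilon> * Y" "\<epsilon> * Y \<le> Y / 4" using \<epsilon> Y0 by (auto simp: field_simps)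
    have near: "3 / 4 * Y \<le> Im z" "norm z \<le> 5 / 4 * Y" if "z \<in> cball (\<i> * of_real Y) (\<epsilon> * Y)" for z
    proof -
      have d: "norm (z - \<i> * of_real Y) \<le> Y / 4"
        using that \<epsilon>Y by (simp add: dist_norm norm_minus_commute)
      show "3 / 4 * Y \<le> Im z" using abs_Im_le_cmod[of "z - \<i> * of_real Y"] d by simp
      show "norm z \<le> 5 / 4 * Y"
        using norm_triangle_sub[of z "\<i> * of_real Y"] d Y0 by (simp add: norm_mult)
    qed
    have "\<exists>v\<in>cball (\<i> * of_real Y) (\<epsilon> * Y). F_transform M v = p"
    proof (rule brouwer_surjective_cball[where S = "{p}"])
      show "continuous_on (cball (\<i> * of_real Y) (\<epsilon> * Y)) (F_transform M)"
      proof (rule continuous_on_subset[OF holomorphic_on_imp_continuous_on[OF holomorphic_F_transform]])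
        show "cball (\<i> * of_real Y) (\<epsilon> * Y) \<subseteq> upper_half_plane"
        proof
          fix z assume "z \<in> cball (\<i> * of_real Y) (\<epsilon> * Y)"
          from near(1)[OF this] Y0 show "z \<in> upper_half_plane" by simp
        qed
      qed
      fix x z assume x: "x \<in> {p}" and z: "z \<in> cball (\<i> * of_real Y) (\<epsilon> * Y)"
      have "z \<noteq> 0" using near(1)[OF z] Y0 by auto
      have "dist (F_transform M z / z) 1 < \<epsilon> / 4"
        using near[OF z] Y R by (intro dist) auto
      moreover have "F_transform M z / z - 1 = (F_transform M z - z) / z"
        using \<open>z \<noteq> 0\<close> by (simp add: field_simps)
      ultimately have "norm (F_transform M z - z) \<le> \<epsilon> / 4 * norm z"
        using \<open>z \<noteq> 0\<close> by (simp add: dist_norm norm_divide divide_less_eq)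
      also have "\<dots> \<le> \<epsilon> / 4 * (5 / 4 * Y)"
        using near(2)[OF z] \<epsilon> by (intro mult_left_mono) auto
      finally have "norm (F_transform M z - z) \<le> \<epsilon> / 4 * (5 / 4 * Y)" .
      then have "norm ((p - \<i> * of_real Y) - (F_transform M z - z)) \<le> \<epsilon> / 4 * Y + \<epsilon> / 4 * (5 / 4 * Y)"
        using norm_triangle_ineq4[of "p - \<i> * of_real Y" "F_transform M z - z"] p by linarith
      also have "\<dots> \<le> \<epsilon> * Y" using \<epsilon>Y \<epsilon> by (simp add: field_simps)
      finally show "x + (z - F_transform M z) \<in> cball (\<i> * of_real Y) (\<epsilon> * Y)"
        using x by (simp add: dist_norm norm_minus_commute algebra_simps)
    qed (use \<epsilon>Y in auto)
    then obtain v where v: "v \<in> cball (\<i> * of_real Y) (\<epsilon> * Y)" "F_transform M v = p" by blast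
    then show ?thesis
      using near(1)[OF v(1)] Y0 by (intro exI[of _ v]) (auto simp: dist_norm norm_minus_commute)
  qed
  then show ?thesis using R by (intro exI[of _ "2 * R"]) auto
qed

lemma univalent_starlike_imp_selfdecomposable:
  assumes inj: "inj_on (F_transform M) upper_half_plane"
    and star: "starlike_wrt_infinity (F_transform M ` upper_half_plane)"
  shows "monotonically_selfdecomposable M"
  unfolding monotonically_selfdecomposable_def
proof
  fix c :: real assume "c \<in> {0<..<1}"
  then have c: "0 < c" "c < 1" by auto
  obtain g where g: "g holomorphic_on F_transform M ` upper_half_plane"
    "\<And>z. z \<in> upper_half_plane \<Longrightarrow> deriv (F_transform M) z * deriv g (F_transform M z) = 1"
    "\<And>z. z \<in> upper_half_plane \<Longrightarrow> g (F_transform M z) = z"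
    using holomorphic_has_inverse[OF holomorphic_F_transform open_upper_half_plane inj] by blast
  have im: "F_transform M z / c \<in> F_transform M ` upper_half_plane" if "0 < Im z" for z
  proof -
    have "(\<lambda>w. complex_of_real (1 / c) * w) ` (F_transform M ` upper_half_plane) \<subseteq> F_transform M ` upper_half_plane"
      using star c unfolding starlike_wrt_infinity_def by (elim allE[of _ "1 / c"]) simp
    moreover have "F_transform M z \<in> F_transform M ` upper_half_plane" using that by simp
    ultimately have "complex_of_real (1 / c) * F_transform M z \<in> F_transform M ` upper_half_plane"
      by (meson image_subset_iff)
    then show ?thesis by simp
  qed
  define N where "N z = c * g (F_transform M z / c)" for z
  have gF: "0 < Im (g (F_transform M z / c))" "F_transform M (g (F_transform M z / c)) = F_transform M z / c"
    if z: "0 < Im z" for z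
  proof -
    from im[OF z] obtain v where "v \<in> upper_half_plane" "F_transform M z / c = F_transform M v" by blast
    then show "0 < Im (g (F_transform M z / c))"
      "F_transform M (g (F_transform M z / c)) = F_transform M z / c"
      using g(3)[of v] by simp_all
  qed
  have "\<exists>\<nu>. real_distribution \<nu> \<and> (\<forall>z. 0 < Im z \<longrightarrow> F_transform \<nu> z = N z)"
  proof (rule F_transform_representation)
    have "(\<lambda>z. g (F_transform M z / c)) holomorphic_on upper_half_plane"
      by (rule holomorphic_on_compose_gen[OF _ g(1), unfolded comp_def])
         (use im c in \<open>auto intro!: holomorphic_intros holomorphic_F_transform\<close>)
    then show "N holomorphic_on upper_half_plane"
      unfolding N_def by (intro holomorphic_intros)
    show "0 < Im (N z)" if "0 < Im z" for z using gF(1)[OF that] c by (simp add: N_def)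
    \<comment> \<open>The value \<open>F (\<i> * y) / c\<close> is close to
      \<open>\<i> * y / c\<close>, hence has a preimage \<open>v\<close> close to
      \<open>\<i> * y / c\<close>. Injectivity of \<open>F\<close> identifies \<open>v\<close> with
      the value of \<open>g\<close>, so \<open>N (\<i> * y) = c * v\<close> is close to
      \<open>\<i> * y\<close>.\<close>
    show "((\<lambda>y. N (\<i> * of_real y) / (\<i> * of_real y)) \<longlongrightarrow> 1) at_top"
    proof (rule tendstoI)
      fix e :: real assume e: "0 < e"
      \<comment> \<open>The bound 1/4 is required for the surjectivity of \<open>F\<close> near the
        axis; halving \<open>e\<close> provides the strict inequality at the end.\<close>
      define \<epsilon> where "\<epsilon> = min (e / 2) (1 / 4)"
      have \<epsilon>: "0 < \<epsilon>" "\<epsilon> \<le> 1 / 4" "\<epsilon> < e" using e by (auto simp: \<epsilon>_def)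
      from F_transform_surjective_near[OF \<epsilon>(1,2)] obtain R where R: "0 < R"
        and surj: "\<And>Y p. R \<le> Y \<Longrightarrow> norm (p - \<i> * of_real Y) \<le> \<epsilon> / 4 * Y \<Longrightarrow>
          \<exists>v. 0 < Im v \<and> norm (v - \<i> * of_real Y) \<le> \<epsilon> * Y \<and> F_transform M v = p"
        by blast
      have "\<forall>\<^sub>F y in at_top. dist (F_transform M (\<i> * of_real y) / (\<i> * of_real y)) 1 < \<epsilon> / 4"
        using F_transform_imaginary_axis[OF real_distribution_axioms] by (rule tendstoD) (use \<epsilon> in simp)
      then show "\<forall>\<^sub>F y in at_top. dist (N (\<i> * of_real y) / (\<i> * of_real y)) 1 < e"
        using eventually_ge_at_top[of R]
      proof eventually_elim
        case (elim y)
        have y: "0 < y" using elim R by simp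
        define p where "p = F_transform M (\<i> * of_real y) / c"
        have "R \<le> y / c"
        proof -
          have "y \<le> y / c" using y c by (simp add: pos_le_divide_eq mult_left_le)
          then show ?thesis using elim(2) by linarith
        qed
        moreover have "p - \<i> * of_real (y / c) =
            (F_transform M (\<i> * of_real y) / (\<i> * of_real y) - 1) * (\<i> * of_real (y / c))"
          using y c by (simp add: p_def field_simps)
        then have "norm (p - \<i> * of_real (y / c)) =
            norm (F_transform M (\<i> * of_real y) / (\<i> * of_real y) - 1) * (y / c)"
          using y c by (simp only: norm_mult norm_ii norm_of_real) simp
        then have "norm (p - \<i> * of_real (y / c)) \<le> \<epsilon> / 4 * (y / c)"
          using elim(1) y c unfolding dist_norm by (simp only:) (intro mult_right_mono; simp)
        ultimately obtain v where v: "0 < Im v" "norm (v - \<i> * of_real (y / c)) \<le> \<epsilon> * (y / c)" "F_transform M v = p"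
          using surj by blast
        have "N (\<i> * of_real y) = c * v" using g(3)[of v] v(1,3) by (simp add: N_def p_def)
        then have "N (\<i> * of_real y) / (\<i> * of_real y) - 1 = (v - \<i> * of_real (y / c)) * (of_real c / (\<i> * of_real y))"
          using y c by (simp add: field_simps)
        then have "norm (N (\<i> * of_real y) / (\<i> * of_real y) - 1) = norm (v - \<i> * of_real (y / c)) * (c / y)"
          using y c by (simp only: norm_mult norm_divide norm_ii norm_of_real)
        also have "\<dots> \<le> \<epsilon> * (y / c) * (c / y)" using v(2) y c by (intro mult_right_mono) auto
        also have "\<dots> = \<epsilon>" using y c by simp
        finally show ?case using \<epsilon>(3) by (simp add: dist_norm)
      qed
    qed
  qed
  then obtain \<nu> where \<nu>: "real_distribution \<nu>" "\<And>z. 0 < Im z \<Longrightarrow> F_transform \<nu> z = N z" by blast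
  have "dilation c M \<rhd>\<^sub>m \<nu> = M"
  proof (rule monotone_convolution_eqI[OF real_distribution_axioms])
    fix z assume z: "0 < Im z"
    show "F_transform M z = F_transform (dilation c M) (F_transform \<nu> z)"
      using gF(2)[OF z] c by (simp add: F_transform_dilation[OF real_distribution_axioms c(1)] \<nu>(2)[OF z] N_def)
  qed
  then show "\<exists>\<nu>. real_distribution \<nu> \<and> M = dilation c M \<rhd>\<^sub>m \<nu>" using \<nu>(1) by metis
qed

end

theorem theorem1p21:
  fixes \<mu> :: "real measure"
  assumes "real_distribution \<mu>"
  defines "a \<equiv> monotonically_selfdecomposable \<mu>"
    and "b \<equiv> univalent_on (F_transform \<mu>) upper_half_plane \<and>
             starlike_wrt_infinity (F_transform \<mu> ` upper_half_plane)"
    and "c \<equiv> \<forall>z\<in>upper_half_plane. Im (deriv (F_transform \<mu>) z / F_transform \<mu> z) \<le> 0"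
    and "d \<equiv> \<exists>\<nu>. real_distribution \<nu> \<and> integrable \<nu> (\<lambda>x. ln (1 + \<bar>x\<bar>)) \<and>
             (\<forall>z\<in>upper_half_plane. F_transform \<mu> z = exp (LINT x|\<nu>. Ln (z - complex_of_real x)))"
  shows "(a \<longleftrightarrow> b) \<and> (b \<longleftrightarrow> c) \<and> (c \<longleftrightarrow> d)"
proof -
  interpret real_distribution \<mu> by fact
  have ac: c if a
    using selfdecomposable_imp_Im_log_deriv that by (simp add: a_def c_def)
  have cd: d if c
    using Im_log_deriv_imp_exp_log_integral that
    unfolding c_def d_def Ball_def upper_half_plane_iff by simp
  have d_imp: "c \<and> b" if d
  proof -
    from that obtain \<nu> where \<nu>: "real_distribution \<nu>" "integrable \<nu> (\<lambda>x. ln (1 + \<bar>x\<bar>))"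
      "\<And>z. 0 < Im z \<Longrightarrow> F_transform \<mu> z = exp (LINT x|\<nu>. Ln (z - complex_of_real x))"
      by (auto simp: d_def)
    interpret exp_log_integral \<mu> \<nu>
      using \<nu> assms(1) by (simp add: exp_log_integral_def exp_log_integral_axioms_def)
    have c
      using log_deriv_F real_distribution.Im_cauchy_transform_neg[OF \<nu>(1)] by (simp add: c_def less_imp_le)
    then show ?thesis
      using univalent_F starlike_F by (simp add: b_def)
  qed
  have ba: a if b
    using that univalent_starlike_imp_selfdecomposable by (simp add: a_def b_def univalent_on_def)
  show ?thesis using ac cd d_imp ba by blast
qed

end
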